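(* Let $1<p<\infty$, $\beta\in\mathbb{R}$, and $\psi\in B\cap\Theta_{p}$. Then there exist positive quantities $K^{(1)}_{\psi,p}$, $K^{(2)}_{\psi,p}$, depending only on $\psi$ and $p$, such that for all $n\in\mathbb{N}$ $$K^{(2)}_{\psi,p}\,\psi(n)\,n^{1/p}\le E_n\big(C^{\psi}_{\beta,p}\big)_C\le \mathcal{E}_n\big(C^{\psi}_{\beta,p}\big)_C\le K^{(1)}_{\psi,p}\,\psi(n)\,n^{1/p}.$$
   Context: All functions are $2\pi$-periodic. $L_p$ ($1\le p\le\infty$) is the space of $2\pi$-periodic measurable functions with finite norm $\|f\|_p=\big(\int_0^{2\pi}|f|^p\big)^{1/p}$ for $p<\infty$ and $\|f\|_\infty=\operatorname{ess\,sup}|f|$; $C$ is the space of continuous $2\pi$-periodic functions with $\|f\|_C=\max|f|$. $\frac1p+\frac1{p'}=1$. Let $\psi(t)>0$ be a continuous function of $t\ge1$; $\psi(k)$ denotes its values at positive integers. For $\beta\in\mathbb{R}$, $\Psi_\beta$ is the summable function with Fourier series $\sum_{k=1}^\infty\psi(k)\cos(kt-\beta\pi/2)$. The class $L^{\psi}_{\beta,p}$ consists of all $f$ that for almost every $x$ satisfy $f(x)=\frac{a_0}{2}+\frac1\pi\int_{-\pi}^{\pi}\Psi_\beta(x-t)\varphi(t)\,dt$ with $a_0\in\mathbb{R}$, $\varphi\perp 1$ (i.e. $\int_{-\pi}^{\pi}\varphi=0$) and $\|\varphi\|_p\le1$. When $\Psi_\beta\in L_{p'}$ these convolutions are continuous,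 and the class of all such $f$ is denoted $C^{\psi}_{\beta,p}$. $\mathcal{T}_{2n-1}$ is the space of trigonometric polynomials of degree at most $n-1$, $S_{n-1}(f)$ is the Fourier partial sum of $f$ of order $n-1$, and $\mathcal{E}_n(C^{\psi}_{\beta,p})_C=\sup_{f\in C^{\psi}_{\beta,p}}\|f-S_{n-1}(f)\|_C$, $E_n(C^{\psi}_{\beta,p})_C=\sup_{f\in C^{\psi}_{\beta,p}}\inf_{t\in\mathcal{T}_{2n-1}}\|f-t\|_C$. $B$ is the set of positive nonincreasing functions $\psi$ on $[1,\infty)$ for which there is a constant $K>0$ with $\psi(t)/\psi(2t)\le K$ for all $t\ge1$. For $1\le p<\infty$, $\Theta_p$ is the set of nonincreasing functions $\psi$ on $[1,\infty)$ for which there exists $\alpha>1/p$ such that $t^\alpha\psi(t)$ is almost decreasing, i.e. there is $K>0$ with $t_1^\alpha\psi(t_1)\le K t_2^\alpha\psi(t_2)$ for all $t_1>t_2\ge1$. (For $\psi\in\Theta_p$ one has $\Psi_\beta\in L_{p'}$.) *)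

theory Defs
  imports "HOL-Analysis.Analysis"
begin

definition periodic2pi :: "(real \<Rightarrow> real) \<Rightarrow> bool" where
  "periodic2pi f \<longleftrightarrow> (\<forall>x. f (x + 2*pi) = f x)"

definition class_B :: "(real \<Rightarrow> real) set" where
  "class_B = {\<psi>. (\<forall>t\<ge>1. 0 < \<psi> t) \<and> (\<forall>s t. 1 \<le> s \<and> s \<le> t \<longrightarrow> \<psi> t \<le> \<psi> s)
      \<and> (\<exists>K>0. \<forall>t\<ge>1. \<psi> t / \<psi> (2*t) \<le> K)}"

definition class_Theta :: "real \<Rightarrow> (real \<Rightarrow> real) set" where
  "class_Theta p = {\<psi>. (\<forall>s t. 1 \<le> s \<and> s \<le> t \<longrightarrow> \<psi> t \<le> \<psi> s)
      \<and> (\<exists>\<alpha>>1/p. \<exists>K>0. \<forall>t1 t2. t1 > t2 \<and> t2 \<ge> 1 \<longrightarrow>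
             t1 powr \<alpha> * \<psi> t1 \<le> K * (t2 powr \<alpha> * \<psi> t2))}"

definition int_pi :: "(real \<Rightarrow> real) \<Rightarrow> real" where
  "int_pi g = (LINT t:{-pi..pi}|lborel. g t)"

text \<open>Psi is (a representative of) Psi_beta: the summable 2pi-periodic function whose Fourier
  series is sum_k psi(k) cos(kt - beta pi/2), i.e. a_0 = 0, a_k = psi k cos(beta pi/2),
  b_k = psi k sin(beta pi/2).\<close>
definition is_Psi :: "(real \<Rightarrow> real) \<Rightarrow> real \<Rightarrow> (real \<Rightarrow> real) \<Rightarrow> bool" where
  "is_Psi \<psi> \<beta> \<Psi> \<longleftrightarrow> periodic2pi \<Psi> \<and> \<Psi> \<in> borel_measurable lborel
     \<and> set_integrable lborel {-pi..pi} \<Psi>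
     \<and> int_pi \<Psi> = 0
     \<and> (\<forall>k::nat. k \<ge> 1 \<longrightarrow>
          (1/pi) * int_pi (\<lambda>t. \<Psi> t * cos (real k * t)) = \<psi> (real k) * cos (\<beta>*pi/2)
        \<and> (1/pi) * int_pi (\<lambda>t. \<Psi> t * sin (real k * t)) = \<psi> (real k) * sin (\<beta>*pi/2))"

definition Lp_ball :: "real \<Rightarrow> (real \<Rightarrow> real) set" where
  "Lp_ball p = {\<phi>. periodic2pi \<phi> \<and> \<phi> \<in> borel_measurable lborel
      \<and> (\<integral>\<^sup>+ t. ennreal (\<bar>\<phi> t\<bar> powr p) * indicator {0..2*pi} t \<partial>lborel) \<le> 1}"

definition conv_pi :: "(real \<Rightarrow> real) \<Rightarrow> (real \<Rightarrow> real) \<Rightarrow> real \<Rightarrow> real" where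
  "conv_pi \<Psi> \<phi> x = (1/pi) * int_pi (\<lambda>t. \<Psi> (x - t) * \<phi> t)"

definition C_class :: "real \<Rightarrow> (real \<Rightarrow> real) \<Rightarrow> (real \<Rightarrow> real) set" where
  "C_class p \<Psi> = {f. continuous_on UNIV f \<and> periodic2pi f \<and>
      (\<exists>a0 \<phi>. \<phi> \<in> Lp_ball p \<and> int_pi \<phi> = 0 \<and>
          (AE x in lborel. f x = a0/2 + conv_pi \<Psi> \<phi> x))}"

definition supnorm :: "(real \<Rightarrow> real) \<Rightarrow> real" where
  "supnorm g = (SUP x. \<bar>g x\<bar>)"

definition trig_polys :: "nat \<Rightarrow> (real \<Rightarrow> real) set" where
  "trig_polys n = {\<tau>. \<exists>c a b. \<tau> = (\<lambda>x. c + (\<Sum>k=1..<n. a k * cos (real k * x) + b k * sin (real k * x)))}"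

definition fourier_cos :: "(real \<Rightarrow> real) \<Rightarrow> nat \<Rightarrow> real" where
  "fourier_cos f k = (1/pi) * int_pi (\<lambda>t. f t * cos (real k * t))"

definition fourier_sin :: "(real \<Rightarrow> real) \<Rightarrow> nat \<Rightarrow> real" where
  "fourier_sin f k = (1/pi) * int_pi (\<lambda>t. f t * sin (real k * t))"

definition fourier_partial_sum :: "nat \<Rightarrow> (real \<Rightarrow> real) \<Rightarrow> real \<Rightarrow> real" where
  "fourier_partial_sum m f x = fourier_cos f 0 / 2
     + (\<Sum>k=1..m. fourier_cos f k * cos (real k * x) + fourier_sin f k * sin (real k * x))"

definition best_approx :: "nat \<Rightarrow> (real \<Rightarrow> real) set \<Rightarrow> ereal" where
  "best_approx n F = (SUP f\<in>F. ereal (INF \<tau>\<in>trig_polys n. supnorm (\<lambda>x. f x - \<tau> x)))"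

definition fourier_dev :: "nat \<Rightarrow> (real \<Rightarrow> real) set \<Rightarrow> ereal" where
  "fourier_dev n F = (SUP f\<in>F. ereal (supnorm (\<lambda>x. f x - fourier_partial_sum (n - 1) f x)))"

end

theory Submission
  imports Defs
begin

text \<open>
  Write \<open>\<gamma> = \<beta>\<pi>/2\<close> and \<open>1/p + 1/q = 1\<close>. Abel summation, combined with splitting the sum at \<open>k \<approx> 1/|t|\<close>
  when \<open>|t| \<le> 1/n\<close>, bounds the tails \<open>\<Sum>k\<ge>n. \<psi>(k) cos(kt - \<gamma>)\<close> by \<open>C \<psi>(n) n^\<alpha> |t|^(\<alpha>-1)\<close> for
  \<open>|t| \<le> 1/n\<close> and by \<open>C \<psi>(n) / |t|\<close> otherwise, uniformly in \<open>\<gamma>\<close>. Since \<open>\<alpha> > 1/p\<close>, their \<open>L_q\<close> norm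
  is at most \<open>C \<psi>(n) n^(1/p)\<close>, and by uniqueness of Fourier coefficients these tails are
  the remainders of \<open>\<Psi>_\<beta>\<close>. Hoelder's inequality gives the upper bound.

  For the lower bound let \<open>F\<close> be the Fejer kernel of order \<open>n\<close> and \<open>N = 2n - 1\<close>. The density
  \<open>\<phi>(t) = c n^(1/p - 1) F(t) cos(Nt)\<close> lies in the \<open>L_p\<close> ball because \<open>0 \<le> F \<le> n\<close> and \<open>\<integral>F = 2\<pi>\<close>.
  The function \<open>F(t) cos(Nt - \<gamma>)\<close> has \<open>L_1\<close> norm at most \<open>2\<pi>\<close> and is orthogonal to polynomials of
  degree less than \<open>n\<close>; pairing it with the convolution of \<open>\<Psi>_\<beta>\<close> and \<open>\<phi>\<close> bounds the best approximation from below by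
  a multiple of \<open>\<psi>(4n) n^(1/p)\<close>, and \<open>\<psi>(4n)\<close> is comparable to \<open>\<psi>(n)\<close> on \<open>B\<close>.
\<close>

section \<open>Integration over a period\<close>

text \<open>A measure in place of set integrals: the theory of finite measures (Hoelder, dominated
  convergence, image measures) then applies without indicator functions.\<close>

definition period :: "real measure" where
  "period = restrict_space lborel {-pi..pi}"

lemma space_period [simp]: "space period = {-pi..pi}"
  by (simp add: period_def space_restrict_space)

lemma measurable_period [measurable (raw)]:
  "f \<in> borel_measurable borel \<Longrightarrow> f \<in> borel_measurable period"
  unfolding period_def by (rule measurable_restrict_space1) simp

lemma finite_measure_period: "finite_measure period"
  by standard (simp add: period_def emeasure_restrict_space space_restrict_space)

interpretation period: finite_measure period
  by (rule finite_measure_period)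

lemma nn_integral_period:
  "(\<integral>\<^sup>+t. g t \<partial>period) = (\<integral>\<^sup>+t. g t * indicator {-pi..pi} t \<partial>lborel)"
  unfolding period_def by (subst nn_integral_restrict_space) auto

lemma int_pi_eq: "int_pi g = (LINT t|period. g t)"
  unfolding int_pi_def period_def set_lebesgue_integral_def
  by (subst integral_restrict_space) auto

lemma set_integrable_period:
  "set_integrable lborel {-pi..pi} (g :: real \<Rightarrow> real) \<longleftrightarrow> integrable period g"
  unfolding period_def set_integrable_def
  by (subst integrable_restrict_space) auto

lemma AE_period: "(AE t in lborel. P t) \<Longrightarrow> AE t in period. P t"
  unfolding period_def by (subst AE_restrict_space_iff) auto

lemma periodic_int_shift:
  fixes g :: "real \<Rightarrow> 'a"
  assumes "\<And>t. g (t + 2*pi) = g t"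
  shows "g (t + 2*pi * of_int m) = g t"
proof (induction m rule: int_induct[where k = 0])
  case base
  show ?case by simp
next
  case (step1 i)
  show ?case
    using assms[of "t + 2*pi * of_int i"] step1 by (simp add: algebra_simps)
next
  case (step2 i)
  show ?case
    using assms[of "t + 2*pi * of_int (i - 1)"] step2 by (simp add: algebra_simps)
qed

text \<open>Moving the window to the right by \<open>d\<close> at most one period cuts off a piece
  on the left and appends its translate on the right. Whole periods reduce an arbitrary
  \<open>a\<close> to such a move starting from \<open>-pi\<close>.\<close>

lemma nn_integral_periodic_interval:
  fixes g :: "real \<Rightarrow> ennreal"
  assumes [measurable]: "g \<in> borel_measurable borel"
    and per: "\<And>t. g (t + 2*pi) = g t"
  shows "(\<integral>\<^sup>+t. g t * indicator {a..a + 2*pi} t \<partial>lborel) = (\<integral>\<^sup>+t. g t \<partial>period)"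
proof -
  \<comment> \<open>Half-open windows make adjacent pieces disjoint, so that \<open>split\<close> is
    exact; the closed window differs by one point.\<close>
  define N where "N a = (\<integral>\<^sup>+t. g t * indicator {a..<a + 2*pi} t \<partial>lborel)" for a
  have closed: "(\<integral>\<^sup>+t. g t * indicator {a..a + 2*pi} t \<partial>lborel) = N a" for a
    unfolding N_def
  proof (rule nn_integral_cong_AE)
    show "AE t in lborel. g t * indicator {a..a + 2*pi} t = g t * indicator {a..<a + 2*pi} t"
      using AE_lborel_singleton[of "a + 2*pi"] by eventually_elim (auto split: split_indicator)
  qed
  have shift: "(\<integral>\<^sup>+t. g t * indicator {a + 2*pi * of_int m..<b + 2*pi * of_int m} t \<partial>lborel)
      = (\<integral>\<^sup>+t. g t * indicator {a..<b} t \<partial>lborel)" for a b and m :: int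
    by (subst nn_integral_real_affine[where c = 1 and t = "2*pi * of_int m"])
       (auto intro!: nn_integral_cong simp: periodic_int_shift[where g = g, OF per] add.commute[of "2*pi * of_int m"]
             split: split_indicator)
  have split: "(\<integral>\<^sup>+t. g t * indicator {a..<c} t \<partial>lborel)
      = (\<integral>\<^sup>+t. g t * indicator {a..<b} t \<partial>lborel) + (\<integral>\<^sup>+t. g t * indicator {b..<c} t \<partial>lborel)"
    if "a \<le> b" "b \<le> c" for a b c
    using that by (subst nn_integral_add[symmetric]) (auto intro!: nn_integral_cong split: split_indicator)
  have small: "N (a + d) = N a" if "0 \<le> d" "d \<le> 2*pi" for a d
  proof -
    have "N (a + d) = (\<integral>\<^sup>+t. g t * indicator {a + d..<a + 2*pi} t \<partial>lborel)
        + (\<integral>\<^sup>+t. g t * indicator {a + 2*pi..<a + d + 2*pi} t \<partial>lborel)"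
      unfolding N_def using that by (intro split) auto
    also have "(\<integral>\<^sup>+t. g t * indicator {a + 2*pi..<a + d + 2*pi} t \<partial>lborel)
        = (\<integral>\<^sup>+t. g t * indicator {a..<a + d} t \<partial>lborel)"
      using shift[of a 1 "a + d"] by simp
    also have "(\<integral>\<^sup>+t. g t * indicator {a + d..<a + 2*pi} t \<partial>lborel)
        + (\<integral>\<^sup>+t. g t * indicator {a..<a + d} t \<partial>lborel) = N a"
      unfolding N_def using that by (subst split[of a "a + d" "a + 2*pi"]) (auto simp: add.commute)
    finally show ?thesis .
  qed
  have "N a = N (-pi)"
  proof -
    define m where "m = \<lfloor>(a + pi) / (2*pi)\<rfloor>"
    define d where "d = a + pi - 2*pi * of_int m"
    have "of_int m \<le> (a + pi) / (2*pi)" "(a + pi) / (2*pi) < of_int m + 1"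
      unfolding m_def by linarith+
    then have d: "0 \<le> d" "d \<le> 2*pi"
      by (simp_all add: d_def field_simps)
    have "N a = N (-pi + d)"
      using shift[of "-pi + d" m "-pi + d + 2*pi"] by (simp add: N_def d_def algebra_simps)
    then show ?thesis
      using small[OF d, of "-pi"] by simp
  qed
  then show ?thesis
    using closed[of a] closed[of "-pi"] by (simp add: nn_integral_period)
qed

text \<open>Equality of image measures yields the reflection rule for Bochner integrals,
  integrability and nonnegative integrals all at once.\<close>

lemma distr_period_reflect:
  fixes g :: "real \<Rightarrow> real"
  assumes [measurable]: "g \<in> borel_measurable borel" and per: "\<And>t. g (t + 2*pi) = g t"
  shows "distr period borel (\<lambda>t. g (x - t)) = distr period borel g"
proof (rule measure_eqI)
  fix A assume "A \<in> sets (distr period borel (\<lambda>t. g (x - t)))"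
  then have [measurable]: "A \<in> sets borel" by simp
  have "emeasure (distr period borel (\<lambda>t. g (x - t))) A = (\<integral>\<^sup>+t. indicator A (g (x - t)) \<partial>period)"
    by (subst nn_integral_indicator[symmetric], simp, subst nn_integral_distr) auto
  also have "\<dots> = (\<integral>\<^sup>+t. indicator A (g (x - t)) * indicator {-pi..pi} t \<partial>lborel)"
    by (simp add: nn_integral_period)
  \<comment> \<open>Substituting \<open>x - t\<close> for \<open>t\<close> carries the window to one
    of length \<open>2*pi\<close> centred at \<open>x\<close>.\<close>
  also have "\<dots> = (\<integral>\<^sup>+t. indicator A (g t) * indicator {x - pi..x - pi + 2*pi} t \<partial>lborel)"
    by (subst nn_integral_real_affine[where c = "-1" and t = x])
       (auto intro!: nn_integral_cong split: split_indicator)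
  also have "\<dots> = (\<integral>\<^sup>+t. indicator A (g t) \<partial>period)"
    by (rule nn_integral_periodic_interval) (auto simp: per)
  also have "\<dots> = emeasure (distr period borel g) A"
    by (subst nn_integral_indicator[symmetric], simp, subst nn_integral_distr) auto
  finally show "emeasure (distr period borel (\<lambda>t. g (x - t))) A = emeasure (distr period borel g) A" .
qed simp

lemma
  fixes g :: "real \<Rightarrow> real"
  assumes [measurable]: "g \<in> borel_measurable borel" and per: "\<And>t. g (t + 2*pi) = g t"
  shows integral_period_reflect: "(LINT t|period. g (x - t)) = (LINT t|period. g t)"
    and integrable_period_reflect: "integrable period (\<lambda>t. g (x - t)) \<longleftrightarrow> integrable period g"
    and nn_integral_period_reflect:
      "h \<in> borel_measurable borel \<Longrightarrow> (\<integral>\<^sup>+t. h (g (x - t)) \<partial>period) = (\<integral>\<^sup>+t. h (g t) \<partial>period)"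
proof -
  note eq = distr_period_reflect[OF assms, of x]
  show "(LINT t|period. g (x - t)) = (LINT t|period. g t)"
    using arg_cong[OF eq, of "\<lambda>M. LINT y|M. y"] by (simp add: integral_distr)
  show "integrable period (\<lambda>t. g (x - t)) \<longleftrightarrow> integrable period g"
    using arg_cong[OF eq, of "\<lambda>M. integrable M (\<lambda>y. y)"] by (simp add: integrable_distr_eq)
  show "(\<integral>\<^sup>+t. h (g (x - t)) \<partial>period) = (\<integral>\<^sup>+t. h (g t) \<partial>period)"
    if [measurable]: "h \<in> borel_measurable borel"
    using arg_cong[OF eq, of "\<lambda>M. \<integral>\<^sup>+y. h y \<partial>M"] by (simp add: nn_integral_distr)
qed

section \<open>Uniqueness of Fourier coefficients\<close>

lemma integrable_period_mult_bounded:
  fixes g h :: "real \<Rightarrow> real"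
  assumes "integrable period g" and [measurable]: "h \<in> borel_measurable borel"
    and "\<And>t. \<bar>h t\<bar> \<le> B"
  shows "integrable period (\<lambda>t. g t * h t)"
proof (rule Bochner_Integration.integrable_bound)
  show "integrable period (\<lambda>t. B * g t)"
    using assms(1) by simp
  have [measurable]: "g \<in> borel_measurable period"
    using assms(1) by (rule borel_measurable_integrable)
  show "(\<lambda>t. g t * h t) \<in> borel_measurable period"
    by measurable
  have "\<bar>g t * h t\<bar> \<le> \<bar>B * g t\<bar>" for t
    using mult_left_mono[OF order_trans[OF assms(3)[of t] abs_ge_self], of "\<bar>g t\<bar>"]
    by (simp add: abs_mult mult.commute)
  then show "AE t in period. norm (g t * h t) \<le> norm (B * g t)"
    by simp
qed

lemma integrable_period_mult_cos [simp]:
  "integrable period g \<Longrightarrow> integrable period (\<lambda>t. g t * cos (a * t + b))"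
  and integrable_period_mult_sin [simp]:
  "integrable period g \<Longrightarrow> integrable period (\<lambda>t. g t * sin (a * t + b))"
  for g :: "real \<Rightarrow> real"
  by (rule integrable_period_mult_bounded[where B = 1]; simp)+

text \<open>Integer frequencies and arbitrary phases make the property stable under multiplication
  by a shifted cosine, since the product formula changes both frequency and phase.\<close>

definition all_frequencies_vanish :: "(real \<Rightarrow> real) \<Rightarrow> bool" where
  "all_frequencies_vanish g \<longleftrightarrow> integrable period g \<and>
     (\<forall>k::int. \<forall>b. (LINT t|period. g t * cos (of_int k * t + b)) = 0)"

lemma all_frequencies_vanish_mult_cos:
  assumes "all_frequencies_vanish g"
  shows "all_frequencies_vanish (\<lambda>t. g t * cos (t + c))"
  unfolding all_frequencies_vanish_def
proof (intro conjI allI)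
  have g: "integrable period g" and zero: "\<And>k b. (LINT t|period. g t * cos (of_int k * t + b)) = 0"
    using assms by (auto simp: all_frequencies_vanish_def)
  show "integrable period (\<lambda>t. g t * cos (t + c))"
    using integrable_period_mult_cos[OF g, of 1 c] by simp
  fix k :: int and b :: real
  have "g t * cos (t + c) * cos (of_int k * t + b)
      = (g t * cos (of_int (k - 1) * t + (b - c)) + g t * cos (of_int (k + 1) * t + (b + c))) / 2" for t
  proof -
    have "cos (t + c) * cos (of_int k * t + b)
        = (cos (t + c - (of_int k * t + b)) + cos (t + c + (of_int k * t + b))) / 2"
      by (rule cos_times_cos)
    also have "cos (t + c - (of_int k * t + b)) = cos (of_int (k - 1) * t + (b - c))"
      by (subst cos_minus[symmetric]) (simp add: algebra_simps)
    also have "t + c + (of_int k * t + b) = of_int (k + 1) * t + (b + c)"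
      by (simp add: algebra_simps)
    finally show ?thesis by (simp add: field_simps)
  qed
  then have "(LINT t|period. g t * cos (t + c) * cos (of_int k * t + b))
      = (LINT t|period. (g t * cos (of_int (k - 1) * t + (b - c)) + g t * cos (of_int (k + 1) * t + (b + c))) / 2)"
    by (simp only:)
  also have "\<dots> = ((LINT t|period. g t * cos (of_int (k - 1) * t + (b - c)))
        + (LINT t|period. g t * cos (of_int (k + 1) * t + (b + c)))) / 2"
    by (subst integral_divide_zero, subst Bochner_Integration.integral_add)
       (use integrable_period_mult_cos[OF g] in auto)
  finally show "(LINT t|period. g t * cos (t + c) * cos (of_int k * t + b)) = 0"
    unfolding zero by simp
qed

lemma all_frequencies_vanish_add:
  assumes "all_frequencies_vanish g" "all_frequencies_vanish h"
  shows "all_frequencies_vanish (\<lambda>t. g t + h t)"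
  using assms by (auto simp: all_frequencies_vanish_def distrib_right)

lemma all_frequencies_vanish_cmult:
  assumes "all_frequencies_vanish g"
  shows "all_frequencies_vanish (\<lambda>t. g t * c)"
proof -
  have "(LINT t|period. g t * c * cos (of_int k * t + b)) = c * (LINT t|period. g t * cos (of_int k * t + b))"
    for k :: int and b
    by (subst integral_mult_right_zero[symmetric]) (simp add: mult_ac)
  then show ?thesis
    using assms by (auto simp: all_frequencies_vanish_def)
qed

text \<open>Induction on the polynomial. The function \<open>g\<close> must vary, because a product
  \<open>P * Q\<close> is absorbed one factor at a time, the second factor being applied to
  \<open>g\<close> times the first.\<close>

lemma all_frequencies_vanish_mult_polynomial:
  fixes P :: "complex \<Rightarrow> real"
  assumes "real_polynomial_function P" "all_frequencies_vanish g"
  shows "all_frequencies_vanish (\<lambda>t. g t * P (cis t))"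
  using assms
proof (induction P arbitrary: g rule: real_polynomial_function.induct)
  case (linear L)
  interpret bounded_linear L by fact
  \<comment> \<open>Sine is a cosine with phase \<open>- pi/2\<close>, so both coordinates on the
    circle are shifted cosines.\<close>
  have "L (cis t) = cos (t + 0) * L 1 + cos (t + (- pi/2)) * L \<i>" for t
  proof -
    have "cis t = cos t *\<^sub>R 1 + sin t *\<^sub>R \<i>"
      by (simp add: complex_eq_iff)
    then have "L (cis t) = cos t * L 1 + sin t * L \<i>"
      by (simp add: add scaleR)
    then show ?thesis
      by (simp add: cos_add sin_add cos_diff)
  qed
  moreover have "all_frequencies_vanish (\<lambda>t. g t * cos (t + 0) * L 1 + g t * cos (t + (- pi/2)) * L \<i>)"
    using linear.prems
    by (intro all_frequencies_vanish_add all_frequencies_vanish_cmult all_frequencies_vanish_mult_cos)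
  ultimately show ?case
    by (simp only: distrib_left mult.assoc)
next
  case (const c)
  then show ?case by (rule all_frequencies_vanish_cmult)
next
  case (add P Q)
  then show ?case by (simp add: distrib_left all_frequencies_vanish_add)
next
  case (mult P Q)
  then show ?case by (simp add: mult.assoc[symmetric])
qed

text \<open>Stone--Weierstrass is applied on the unit circle, where the polynomials in \<open>Re z\<close> and \<open>Im z\<close>
  are the trigonometric polynomials; this avoids gluing the end points of the period.\<close>
lemma all_frequencies_vanish_orthogonal_continuous:
  fixes H :: "complex \<Rightarrow> real"
  assumes van: "all_frequencies_vanish g" and cont: "continuous_on UNIV H"
  shows "(LINT t|period. g t * H (cis t)) = 0"
proof -
  have g: "integrable period g"
    using van by (simp add: all_frequencies_vanish_def)
  have [measurable]: "H \<in> borel_measurable borel"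
    using cont by (rule borel_measurable_continuous_onI)
  have [measurable]: "cis \<in> borel_measurable borel"
    by (intro borel_measurable_continuous_onI continuous_intros)
  obtain B where B: "\<bar>H z\<bar> \<le> B" if "z \<in> sphere 0 1" for z
  proof -
    have "compact (H ` sphere 0 1)"
      by (intro compact_continuous_image continuous_on_subset[OF cont]) auto
    then show thesis
      using that by (force dest!: compact_imp_bounded simp: bounded_iff)
  qed
  have gH: "integrable period (\<lambda>t. g t * H (cis t))"
    by (rule integrable_period_mult_bounded[OF g, where B = B]) (auto intro: B)
  have "\<bar>LINT t|period. g t * H (cis t)\<bar> \<le> e * (LINT t|period. \<bar>g t\<bar>)" if "e > 0" for e
  proof -
    obtain P where P: "real_polynomial_function P" "\<And>z. z \<in> sphere 0 1 \<Longrightarrow> \<bar>H z - P z\<bar> < e"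
      using Stone_Weierstrass_real_polynomial_function[OF compact_sphere
          continuous_on_subset[OF cont subset_UNIV] \<open>e > 0\<close>] by blast
    have gP: "all_frequencies_vanish (\<lambda>t. g t * P (cis t))"
      by (rule all_frequencies_vanish_mult_polynomial[OF P(1) van])
    then have iP: "integrable period (\<lambda>t. g t * P (cis t))" and "(LINT t|period. g t * P (cis t)) = 0"
      unfolding all_frequencies_vanish_def by (auto dest!: spec[where x = "0::int"] spec[where x = "0::real"])
    then have "(LINT t|period. g t * H (cis t)) = (LINT t|period. g t * (H (cis t) - P (cis t)))"
      using gH by (simp add: right_diff_distrib)
    also have "\<bar>\<dots>\<bar> \<le> (LINT t|period. \<bar>g t * (H (cis t) - P (cis t))\<bar>)"
      using integral_norm_bound[of period "\<lambda>t. g t * (H (cis t) - P (cis t))"] by simp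
    also have "\<dots> \<le> (LINT t|period. e * \<bar>g t\<bar>)"
    proof (rule integral_mono)
      show "integrable period (\<lambda>t. \<bar>g t * (H (cis t) - P (cis t))\<bar>)"
        using gH iP by (intro integrable_abs) (simp add: right_diff_distrib)
      show "integrable period (\<lambda>t. e * \<bar>g t\<bar>)"
        using g by simp
      show "\<bar>g t * (H (cis t) - P (cis t))\<bar> \<le> e * \<bar>g t\<bar>" for t
        using mult_right_mono[OF less_imp_le[OF P(2)[of "cis t"]], of "\<bar>g t\<bar>"]
        by (simp add: abs_mult mult.commute)
    qed
    finally show ?thesis by simp
  qed
  note bound = this
  define C where "C = (LINT t|period. \<bar>g t\<bar>)"
  have "C \<ge> 0"
    unfolding C_def by (rule integral_nonneg_AE) simp
  have "\<bar>LINT t|period. g t * H (cis t)\<bar> \<le> 0"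
  proof (rule field_le_epsilon)
    fix e :: real assume "e > 0"
    \<comment> \<open>The denominator is \<open>C + 1\<close> because \<open>C\<close> may be
      zero.\<close>
    have "\<bar>LINT t|period. g t * H (cis t)\<bar> \<le> e / (C + 1) * C"
      unfolding C_def[symmetric] by (rule bound[folded C_def]) (use \<open>e > 0\<close> \<open>C \<ge> 0\<close> in simp)
    also have "\<dots> \<le> e"
      using \<open>e > 0\<close> \<open>C \<ge> 0\<close> by (simp add: field_simps)
    finally show "\<bar>LINT t|period. g t * H (cis t)\<bar> \<le> 0 + e" by simp
  qed
  then show ?thesis by simp
qed

text \<open>The indicator of a closed set is the pointwise limit of the continuous cut-offs
  \<open>H m\<close>, which lie between 0 and 1, so dominated convergence applies. Nonemptiness
  matters because \<open>infdist\<close> to the empty set is 0 by convention.\<close>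

lemma all_frequencies_vanish_closed:
  fixes A :: "complex set"
  assumes van: "all_frequencies_vanish g" and "closed A" "A \<noteq> {}"
  shows "(LINT t|period. g t * indicator A (cis t)) = 0"
proof -
  have g: "integrable period g"
    using van by (simp add: all_frequencies_vanish_def)
  have [measurable]: "g \<in> borel_measurable period"
    using g by (rule borel_measurable_integrable)
  have [measurable]: "A \<in> sets borel"
    using \<open>closed A\<close> by simp
  have [measurable]: "cis \<in> borel_measurable borel"
    by (intro borel_measurable_continuous_onI continuous_intros)
  define H where "H m z = max 0 (1 - real m * infdist z A)" for m z
  have cont: "continuous_on UNIV (H m)" for m
    unfolding H_def by (intro continuous_intros)
  have [measurable]: "H m \<in> borel_measurable borel" for m
    using cont by (rule borel_measurable_continuous_onI)
  have lim: "(\<lambda>m. H m z) \<longlonglongrightarrow> indicator A z" for z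
  proof (cases "z \<in> A")
    case True
    then show ?thesis by (simp add: H_def)
  next
    case False
    then have "infdist z A > 0"
      using assms infdist_pos_not_in_closed by blast
    then obtain M where M: "real M * infdist z A > 1"
      using reals_Archimedean3 by blast
    have "H m z = 0" if "m \<ge> M" for m
    proof -
      have "real M * infdist z A \<le> real m * infdist z A"
        using that by (intro mult_right_mono) (auto simp: infdist_nonneg)
      then show ?thesis using M by (simp add: H_def)
    qed
    then have "eventually (\<lambda>m. H m z = 0) sequentially"
      using eventually_sequentially by blast
    then show ?thesis
      using False by (simp add: tendsto_eventually)
  qed
  have "(\<lambda>m. LINT t|period. g t * H m (cis t)) \<longlonglongrightarrow> (LINT t|period. g t * indicator A (cis t))"
  proof (rule integral_dominated_convergence)
    show "integrable period (\<lambda>t. \<bar>g t\<bar>)"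
      using g by simp
    show "AE t in period. (\<lambda>m. g t * H m (cis t)) \<longlonglongrightarrow> g t * indicator A (cis t)"
      using lim by (auto intro!: tendsto_intros)
    have "\<bar>H m z\<bar> \<le> 1" for m z
      using infdist_nonneg[of z A] by (simp add: H_def)
    then show "AE t in period. norm (g t * H m (cis t)) \<le> \<bar>g t\<bar>" for m
      by (intro AE_I2) (simp add: abs_mult mult_left_le)
  qed measurable
  then show ?thesis
    using all_frequencies_vanish_orthogonal_continuous[OF van cont] by (simp add: LIMSEQ_const_iff)
qed

text \<open>\<open>Arg\<close> inverts \<open>cis\<close> on the interval from \<open>-pi\<close>
  (excluded) to \<open>pi\<close> (included). The point \<open>-pi\<close> has to be left out, since
  \<open>cis\<close> sends it to the same point as \<open>pi\<close>.\<close>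

lemma cis_image_atLeastAtMost:
  assumes "-pi < t" "t \<le> pi" "-pi < a"
  shows "cis t \<in> cis ` {a..pi} \<longleftrightarrow> a \<le> t"
proof
  assume "cis t \<in> cis ` {a..pi}"
  then obtain s where s: "a \<le> s" "s \<le> pi" "cis t = cis s" by auto
  have "t = Arg (cis t)"
    using assms by (simp add: Arg_cis)
  also have "\<dots> = s"
    unfolding s(3) by (rule Arg_cis) (use s assms in auto)
  finally show "a \<le> t" using s by simp
qed (use assms in auto)

text \<open>The positive and negative parts of \<open>u\<close> are densities of two finite measures
  that agree on all open right half-lines, hence everywhere; densities are unique almost
  everywhere.\<close>

lemma AE_zero_if_integral_greaterThan_zero:
  fixes u :: "real \<Rightarrow> real"
  assumes u: "integrable lborel u" and zero: "\<And>x. (LINT t|lborel. u t * indicator {x<..} t) = 0"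
  shows "AE t in lborel. u t = 0"
proof -
  have [measurable]: "u \<in> borel_measurable borel"
    using borel_measurable_integrable[OF u] by simp
  have fin: "(\<integral>\<^sup>+t. ennreal (u t) \<partial>lborel) < \<infinity>" "(\<integral>\<^sup>+t. ennreal (- u t) \<partial>lborel) < \<infinity>"
    using u by (auto simp: real_integrable_def less_top)
  have "density lborel (\<lambda>t. ennreal (u t)) = density lborel (\<lambda>t. ennreal (- u t))"
  proof (rule measure_eqI_lessThan)
    fix x
    have *: "emeasure (density lborel (\<lambda>t. ennreal (f t))) {x<..} = (\<integral>\<^sup>+t. ennreal (f t * indicator {x<..} t) \<partial>lborel)"
      if [measurable]: "f \<in> borel_measurable borel" for f :: "real \<Rightarrow> real"
      by (subst emeasure_density) (auto intro!: nn_integral_cong split: split_indicator)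
    have le: "(\<integral>\<^sup>+t. ennreal (f t * indicator {x<..} t) \<partial>lborel) \<le> (\<integral>\<^sup>+t. ennreal (f t) \<partial>lborel)"
      for f :: "real \<Rightarrow> real"
      by (intro nn_integral_mono) (auto split: split_indicator)
    have i: "integrable lborel (\<lambda>t. u t * indicator {x<..} t)"
      using u by (intro integrable_real_mult_indicator) auto
    show "emeasure (density lborel (\<lambda>t. ennreal (u t))) {x<..} < \<infinity>"
      using le[of u] fin(1) by (simp add: *)
    have "(\<integral>\<^sup>+t. ennreal (- u t * indicator {x<..} t) \<partial>lborel) < \<infinity>"
      using le_less_trans[OF le[of "\<lambda>t. - u t"] fin(2)] .
    moreover have "(\<integral>\<^sup>+t. ennreal (u t * indicator {x<..} t) \<partial>lborel) < \<infinity>"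
      using le_less_trans[OF le[of u] fin(1)] .
    moreover have "enn2real (\<integral>\<^sup>+t. ennreal (u t * indicator {x<..} t) \<partial>lborel)
        = enn2real (\<integral>\<^sup>+t. ennreal (- u t * indicator {x<..} t) \<partial>lborel)"
      using zero[of x] by (subst (asm) real_lebesgue_integral_def[OF i]) simp
    \<comment> \<open>Both sides are finite, so equality of their real values lifts to
      \<open>ennreal\<close>.\<close>
    ultimately have "(\<integral>\<^sup>+t. ennreal (u t * indicator {x<..} t) \<partial>lborel)
        = (\<integral>\<^sup>+t. ennreal (- u t * indicator {x<..} t) \<partial>lborel)"
      by (metis ennreal_enn2real infinity_ennreal_def)
    then show "emeasure (density lborel (\<lambda>t. ennreal (u t))) {x<..}
        = emeasure (density lborel (\<lambda>t. ennreal (- u t))) {x<..}"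
      by (simp add: *)
  qed simp_all
  then have "AE t in lborel. ennreal (u t) = ennreal (- u t)"
    by (intro sigma_finite_measure.density_unique[OF sigma_finite_lborel]) auto
  then show ?thesis
  proof eventually_elim
    case (elim t)
    \<comment> \<open>Since \<open>ennreal\<close> truncates negative numbers to 0, one side of the
      equation is 0, and so the other is too.\<close>
    then show ?case
      by (cases "u t \<ge> 0") (auto simp: ennreal_neg ennreal_eq_0_iff)
  qed
qed

text \<open>The integral of \<open>g\<close> over every closed arc vanishes. Arcs ending at the
  point \<open>cis pi\<close> correspond to half-lines cut down to the period, and integrals over
  half-lines determine \<open>g\<close> almost everywhere.\<close>

lemma fourier_uniqueness:
  assumes "integrable period g"
    and zero_cos: "\<And>k::nat. (LINT t|period. g t * cos (real k * t)) = 0"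
    and zero_sin: "\<And>k::nat. (LINT t|period. g t * sin (real k * t)) = 0"
  shows "AE t in lborel. t \<in> {-pi..pi} \<longrightarrow> g t = 0"
proof -
  have g: "integrable period g" by fact
  have [simp]: "integrable period (\<lambda>t. g t * cos (a * t))" "integrable period (\<lambda>t. g t * sin (a * t))" for a
    using integrable_period_mult_cos[OF g, of a 0] integrable_period_mult_sin[OF g, of a 0] by auto
  have "(LINT t|period. g t * cos (of_int k * t + b)) = 0" for k :: int and b
  proof -
    have zc: "(LINT t|period. g t * cos (of_int k * t)) = 0"
      using zero_cos[of "nat \<bar>k\<bar>"] by (cases "k \<ge> 0") simp_all
    have zs: "(LINT t|period. g t * sin (of_int k * t)) = 0"
    proof (cases "k \<ge> 0")
      case False
      then show ?thesis using zero_sin[of "nat \<bar>k\<bar>"] by simp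
    qed (use zero_sin[of "nat \<bar>k\<bar>"] in simp)
    have "g t * cos (of_int k * t + b) = cos b * (g t * cos (of_int k * t)) - sin b * (g t * sin (of_int k * t))" for t
      by (simp add: cos_add algebra_simps)
    then have "(LINT t|period. g t * cos (of_int k * t + b))
      = cos b * (LINT t|period. g t * cos (of_int k * t)) - sin b * (LINT t|period. g t * sin (of_int k * t))"
      by simp
    then show ?thesis using zc zs by simp
  qed
  then have van: "all_frequencies_vanish g"
    using g by (simp add: all_frequencies_vanish_def)
  define u where "u t = g t * indicator {-pi..pi} t" for t
  have restr: "(LINT t|period. g t * h t) = (LINT t|lborel. u t * h t)" for h :: "real \<Rightarrow> real"
    unfolding period_def u_def by (subst integral_restrict_space) (auto simp: mult_ac)
  have u: "integrable lborel u"
    using g unfolding period_def u_def by (subst (asm) integrable_restrict_space) (auto simp: mult_ac)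
  have "(LINT t|lborel. u t * indicator {x<..} t) = 0" for x
  proof -
    have full: "(LINT t|lborel. u t) = 0"
      using restr[of "\<lambda>_. 1"] zero_cos[of 0] by simp
    \<comment> \<open>The arc argument requires \<open>-pi < x\<close>. The other cases give an
      empty window or the full period, up to one point when \<open>x = -pi\<close>.\<close>
    consider "x \<ge> pi" | "x < -pi" | "-pi < x" "x < pi" | "x = -pi" by linarith
    then show ?thesis
    proof cases
      case 1
      then have "u t * indicator {x<..} t = 0" for t
        by (auto simp: u_def split: split_indicator)
      then show ?thesis by (simp only: Bochner_Integration.integral_zero)
    next
      case 2
      then have "u t * indicator {x<..} t = u t" for t
        by (auto simp: u_def split: split_indicator)
      then show ?thesis using full by (simp only:)
    next
      case 3
      define A where "A = cis ` {x..pi}"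
      have "compact A"
        unfolding A_def by (intro compact_continuous_image continuous_intros) auto
      moreover have "A \<noteq> {}"
        using 3 by (simp add: A_def)
      ultimately have 0: "(LINT t|lborel. u t * indicator A (cis t)) = 0"
        by (subst restr[symmetric], intro all_frequencies_vanish_closed van) (auto simp: compact_imp_closed)
      have [measurable]: "u \<in> borel_measurable borel"
        using borel_measurable_integrable[OF u] by simp
      have [measurable]: "cis \<in> borel_measurable borel"
        by (intro borel_measurable_continuous_onI continuous_intros)
      have [measurable]: "A \<in> sets borel"
        using \<open>compact A\<close> by (simp add: borel_compact)
      have "AE t in lborel. u t * indicator {x<..} t = u t * indicator A (cis t)"
        using AE_lborel_singleton[of x] AE_lborel_singleton[of "-pi"]
      proof eventually_elim
        case (elim t)
        show ?case
        proof (cases "-pi < t \<and> t \<le> pi")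
          case True
          then have "cis t \<in> A \<longleftrightarrow> x \<le> t"
            unfolding A_def by (intro cis_image_atLeastAtMost) (use 3 in auto)
          also have "x \<le> t \<longleftrightarrow> x < t"
            using elim(1) by linarith
          finally show ?thesis
            by (simp add: indicator_def)
        next
          case False
          then have "u t = 0"
            using elim by (auto simp: u_def)
          then show ?thesis by simp
        qed
      qed
      then have "(LINT t|lborel. u t * indicator {x<..} t) = (LINT t|lborel. u t * indicator A (cis t))"
        by (intro integral_cong_AE) auto
      then show ?thesis using 0 by simp
    next
      case 4
      have "(LINT t|lborel. u t * indicator {x<..} t) = (LINT t|lborel. u t)"
      proof (rule integral_cong_AE)
        show "AE t in lborel. u t * indicator {x<..} t = u t"
          using AE_lborel_singleton[of x]
          by eventually_elim (use 4 in \<open>auto simp: u_def split: split_indicator\<close>)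
      next
        show "u \<in> borel_measurable lborel"
          using u by (rule borel_measurable_integrable)
        then show "(\<lambda>t. u t * indicator {x<..} t) \<in> borel_measurable lborel"
          by measurable
      qed
      then show ?thesis using full by simp
    qed
  qed
  from AE_zero_if_integral_greaterThan_zero[OF u this] show ?thesis
    by eventually_elim (auto simp: u_def)
qed

section \<open>Trigonometric sums with slowly decaying coefficients\<close>

text \<open>Sine is concave on the interval and therefore lies above its chord.\<close>

lemma jordan_inequality:
  fixes x :: real
  assumes "0 \<le> x" "x \<le> pi/2"
  shows "2 * x / pi \<le> sin x"
proof -
  have "convex_on {0..pi/2} (\<lambda>x. - sin x)"
  proof (rule f''_ge0_imp_convex)
    show "((\<lambda>x. - sin x) has_real_derivative - cos x) (at x)" for x :: real
      by (auto intro!: derivative_eq_intros)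
    show "((\<lambda>x. - cos x) has_real_derivative sin x) (at x)" for x :: real
      by (auto intro!: derivative_eq_intros)
    show "0 \<le> sin x" if "x \<in> {0..pi/2}" for x :: real
      using that by (intro sin_ge_zero) auto
  qed simp
  from convex_onD[OF this, of "2 * x / pi" 0 "pi/2"] show ?thesis
    using assms by (simp add: field_simps)
qed

text \<open>Multiplication by \<open>2 * sin (t/2)\<close> makes the sum telescope to a difference
  of two sines, and Jordan's inequality bounds \<open>sin (t/2)\<close> away from 0. The bound is
  uniform in the phase and in both ends of summation.\<close>

lemma abs_sum_cos_le:
  fixes t :: real
  assumes "t \<noteq> 0" "\<bar>t\<bar> \<le> pi"
  shows "\<bar>\<Sum>k=n..<N. cos (real k * t - \<gamma>)\<bar> \<le> pi / \<bar>t\<bar>"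
proof (cases "n \<le> N")
  case True
  have "2 * sin (t/2) * (\<Sum>k=n..<N. cos (real k * t - \<gamma>))
      = sin ((real N - 1/2) * t - \<gamma>) - sin ((real n - 1/2) * t - \<gamma>)"
    using True
  proof (induction N rule: dec_induct)
    case (step N)
    have "sin ((real (Suc N) - 1/2) * t - \<gamma>) - sin ((real N - 1/2) * t - \<gamma>)
        = 2 * sin (t/2) * cos (real N * t - \<gamma>)"
    proof -
      have "((real (Suc N) - 1/2) * t - \<gamma> - ((real N - 1/2) * t - \<gamma>)) / 2 = t / 2"
        "((real (Suc N) - 1/2) * t - \<gamma> + ((real N - 1/2) * t - \<gamma>)) / 2 = real N * t - \<gamma>"
        by (simp_all add: field_simps)
      then show ?thesis
        by (simp only: sin_diff_sin)
    qed
    then show ?case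
      using step by (simp add: distrib_left)
  qed simp
  then have "2 * \<bar>sin (t/2)\<bar> * \<bar>\<Sum>k=n..<N. cos (real k * t - \<gamma>)\<bar>
      = \<bar>sin ((real N - 1/2) * t - \<gamma>) - sin ((real n - 1/2) * t - \<gamma>)\<bar>"
    by (metis abs_mult abs_numeral)
  also have "\<dots> \<le> 2"
    using abs_sin_le_one[of "(real N - 1/2) * t - \<gamma>"] abs_sin_le_one[of "(real n - 1/2) * t - \<gamma>"]
    by linarith
  finally have le: "\<bar>sin (t/2)\<bar> * \<bar>\<Sum>k=n..<N. cos (real k * t - \<gamma>)\<bar> \<le> 1" by simp
  have "\<bar>t\<bar> / pi \<le> sin (\<bar>t\<bar>/2)"
    using jordan_inequality[of "\<bar>t\<bar>/2"] assms by simp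
  also have "\<dots> \<le> \<bar>sin (t/2)\<bar>"
    by (cases "t \<ge> 0") auto
  finally have "\<bar>t\<bar> / pi * \<bar>\<Sum>k=n..<N. cos (real k * t - \<gamma>)\<bar> \<le> 1"
    using le by (meson abs_ge_zero mult_right_mono order_trans)
  then show ?thesis
    using assms by (simp add: field_simps)
qed simp

text \<open>Abel summation: the weights \<open>a k - a (Suc k)\<close> and the last
  \<open>a N\<close> are nonnegative and add up to \<open>a n\<close>.\<close>

lemma abs_sum_antimono_mult_le:
  fixes a c :: "nat \<Rightarrow> real"
  assumes anti: "\<And>k. n \<le> k \<Longrightarrow> a (Suc k) \<le> a k" and pos: "\<And>k. n \<le> k \<Longrightarrow> 0 \<le> a k"
    and B: "\<And>m. \<bar>\<Sum>k=n..<m. c k\<bar> \<le> B"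
  shows "\<bar>\<Sum>k=n..<N. a k * c k\<bar> \<le> a n * B"
proof (cases "n \<le> N")
  case True
  define S where "S m = (\<Sum>k=n..<m. c k)" for m
  have "(\<Sum>k=n..<N. a k * c k) = (\<Sum>k=n..<N. (a k - a (Suc k)) * S (Suc k)) + a N * S N"
    using True
  proof (induction N rule: dec_induct)
    case (step m)
    then have "S (Suc m) = S m + c m"
      by (simp add: S_def)
    then show ?case
      using step by (simp add: algebra_simps)
  qed (simp add: S_def)
  also have "\<bar>\<dots>\<bar> \<le> (\<Sum>k=n..<N. (a k - a (Suc k)) * B) + a N * B"
  proof (intro order_trans[OF abs_triangle_ineq] add_mono order_trans[OF sum_abs] sum_mono)
    show "\<bar>(a k - a (Suc k)) * S (Suc k)\<bar> \<le> (a k - a (Suc k)) * B" if "k \<in> {n..<N}" for k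
      using that anti[of k] B[of "Suc k"] by (simp only: abs_mult) (auto simp: S_def intro!: mult_mono)
    show "\<bar>a N * S N\<bar> \<le> a N * B"
      using True pos[of N] B[of N] by (simp add: abs_mult S_def mult_left_mono)
  qed
  also have "\<dots> = a n * B"
  proof -
    have *: "(\<Sum>k=n..<N. a k - a (Suc k)) = a n - a N"
      using sum_Suc_diff'[OF True, of "\<lambda>k. - a k"] by simp
    show ?thesis
      unfolding sum_distrib_right[symmetric] * by (simp add: algebra_simps)
  qed
  finally show ?thesis .
next
  case False
  \<comment> \<open>The sum is empty here, and the hypothesis on an empty partial sum gives that
    \<open>B\<close> is nonnegative.\<close>
  then show ?thesis
    using pos[of n] B[of 0] by simp
qed

text \<open>A discrete form of integrating x^(s-1). The induction step is the Bernoulli-type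
  inequality y^s <= s y + 1 - s at y = m/(m+1), an instance of weighted AM-GM.\<close>

lemma sum_powr_le:
  fixes s :: real
  assumes "0 < s" "s < 1"
  shows "(\<Sum>k=1..m. real k powr (s - 1)) \<le> real m powr s / s"
proof (induction m)
  case (Suc m)
  have "real m powr s \<le> real (Suc m) powr s - s * real (Suc m) powr (s - 1)"
  proof (cases "m = 0")
    case False
    define y where "y = real m / real (Suc m)"
    have "y powr s * 1 powr (1 - s) \<le> s * y + (1 - s) * 1"
      using assms False by (intro Youngs_inequality_0) (auto simp: y_def)
    also have "\<dots> = 1 - s / real (Suc m)"
      by (simp add: y_def field_simps)
    finally have "real (Suc m) powr s * y powr s \<le> real (Suc m) powr s * (1 - s / real (Suc m))"
      by (intro mult_left_mono) auto
    moreover have "real (Suc m) powr s * y powr s = real m powr s"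
      unfolding y_def by (subst powr_divide) auto
    moreover have "real (Suc m) powr s * (1 - s / real (Suc m))
        = real (Suc m) powr s - s * real (Suc m) powr (s - 1)"
      by (simp add: powr_diff right_diff_distrib)
    ultimately show ?thesis
      by (simp only:)
  qed (use assms in simp)
  then have "(real m powr s + s * real (Suc m) powr (s - 1)) / s \<le> real (Suc m) powr s / s"
    using assms by (intro divide_right_mono) auto
  then have "real m powr s / s + real (Suc m) powr (s - 1) \<le> real (Suc m) powr s / s"
    using assms by (simp add: add_divide_distrib)
  then show ?case
    using Suc by simp
qed simp

text \<open>The properties of a k = \<psi>(k) that the estimates use. The bound \<alpha> < 1 makes
  partial sums of k^(-\<alpha>) grow like m^(1-\<alpha>); 1/p < \<alpha> makes the resulting
  singularity at 0 a function in L_q.\<close>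

locale decaying_coeffs =
  fixes a :: "nat \<Rightarrow> real" and \<alpha> K p :: real
  assumes p: "1 < p"
    and \<alpha>: "1/p < \<alpha>" "\<alpha> < 1"
    and K: "1 \<le> K"
    and pos: "1 \<le> k \<Longrightarrow> 0 < a k"
    and antimono: "1 \<le> k \<Longrightarrow> k \<le> l \<Longrightarrow> a l \<le> a k"
    and decay: "1 \<le> k \<Longrightarrow> k \<le> l \<Longrightarrow> real l powr \<alpha> * a l \<le> K * (real k powr \<alpha> * a k)"
begin

lemma \<alpha>_pos: "0 < \<alpha>"
  using p \<alpha> by (meson divide_pos_pos less_trans zero_less_one)

definition block :: "real \<Rightarrow> nat \<Rightarrow> nat \<Rightarrow> real \<Rightarrow> real" where
  "block \<gamma> n N t = (\<Sum>k=n..<N. a k * cos (real k * t - \<gamma>))"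

text \<open>The shape of the remainder after \<open>n - 1\<close> terms, without the factor
  \<open>a n\<close>. For \<open>n\<close> at least 1 the two branches meet at |t| = 1/n with the
  common value \<open>n\<close>.\<close>

definition envelope :: "nat \<Rightarrow> real \<Rightarrow> real" where
  "envelope n t = (if \<bar>t\<bar> \<le> 1 / real n then real n powr \<alpha> * \<bar>t\<bar> powr (\<alpha> - 1) else 1 / \<bar>t\<bar>)"

text \<open>The first summand comes from the terms with k <= 1/|t|, the second from Abel summation
  beyond them.\<close>

definition block_const :: real where
  "block_const = K / (1 - \<alpha>) + K * pi"

lemma block_const_pos: "0 < block_const"
  using K \<alpha> by (auto simp: block_const_def intro!: add_pos_pos)

lemma abs_block_le_inverse:
  assumes "1 \<le> n" "t \<noteq> 0" "\<bar>t\<bar> \<le> pi"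
  shows "\<bar>block \<gamma> n N t\<bar> \<le> a n * (pi / \<bar>t\<bar>)"
  unfolding block_def
proof (rule abs_sum_antimono_mult_le)
  show "a (Suc k) \<le> a k" "0 \<le> a k" if "n \<le> k" for k
    using that assms antimono[of k "Suc k"] pos[of k] by auto
qed (rule abs_sum_cos_le[OF assms(2,3)])

lemma coeff_le:
  assumes "1 \<le> n" "n \<le> k"
  shows "a k \<le> K * a n * real n powr \<alpha> * real k powr (- \<alpha>)"
proof -
  have "a k = (real k powr \<alpha> * a k) * real k powr (- \<alpha>)"
    using assms by (simp add: powr_minus field_simps)
  also have "\<dots> \<le> (K * (real n powr \<alpha> * a n)) * real k powr (- \<alpha>)"
    using decay[OF assms] by (intro mult_right_mono) auto
  finally show ?thesis by (simp add: mult_ac)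
qed

text \<open>Away from 0, Abel summation from \<open>n\<close> suffices. Near 0 the block is cut at
  m, the integer part of 1/|t|: up to \<open>m\<close> the coefficients are compared with
  k^(-\<alpha>) and cancellation is ignored, while beyond \<open>m\<close> Abel summation starts
  from the already small coefficient \<open>a (Suc m)\<close>.\<close>

lemma abs_block_le_envelope:
  assumes n: "1 \<le> n" and t: "t \<noteq> 0" "\<bar>t\<bar> \<le> pi"
  shows "\<bar>block \<gamma> n N t\<bar> \<le> block_const * a n * envelope n t"
proof (cases "\<bar>t\<bar> \<le> 1 / real n")
  case False
  have "\<bar>block \<gamma> n N t\<bar> \<le> pi * a n * (1 / \<bar>t\<bar>)"
    using abs_block_le_inverse[OF assms] by (simp add: mult_ac)
  also have "\<dots> \<le> block_const * a n * (1 / \<bar>t\<bar>)"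
  proof -
    have "pi \<le> K * pi"
      using K by simp
    also have "\<dots> \<le> block_const"
      using K \<alpha> by (simp add: block_const_def)
    finally show ?thesis
      using pos[OF n] by (intro mult_right_mono) auto
  qed
  finally show ?thesis
    using False by (simp add: envelope_def)
next
  case True
  define m where "m = nat \<lfloor>1 / \<bar>t\<bar>\<rfloor>"
  have m: "real m \<le> 1 / \<bar>t\<bar>" "1 / \<bar>t\<bar> \<le> real (Suc m)"
    unfolding m_def by (auto simp: of_nat_nat) linarith
  have "real n \<le> 1 / \<bar>t\<bar>"
    using True n t by (simp add: field_simps)
  then have "n \<le> m"
    unfolding m_def by (simp add: le_nat_floor)
  have an: "0 < a n" using pos[OF n] .
  define A where "A = K * a n * real n powr \<alpha>"
  have "0 \<le> A"
    using K an by (simp add: A_def)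
  \<comment> \<open>Any \<open>L\<close> up to \<open>Suc m\<close> is allowed, since the block
    itself may end before the cut.\<close>
  have head: "\<bar>block \<gamma> n L t\<bar> \<le> A * \<bar>t\<bar> powr (\<alpha> - 1) / (1 - \<alpha>)" if "L \<le> Suc m" for L
  proof -
    have "\<bar>block \<gamma> n L t\<bar> \<le> (\<Sum>k=n..<L. a k)"
      unfolding block_def
    proof (intro order_trans[OF sum_abs] sum_mono)
      fix k assume "k \<in> {n..<L}"
      then have "0 < a k" using n pos[of k] by simp
      then show "\<bar>a k * cos (real k * t - \<gamma>)\<bar> \<le> a k"
        by (simp add: abs_mult mult_left_le)
    qed
    \<comment> \<open>The exponent -\<alpha> is written in the form required by
      \<open>sum_powr_le\<close> with s = 1 - \<alpha>.\<close>
    also have "\<dots> \<le> (\<Sum>k=n..<L. A * real k powr ((1 - \<alpha>) - 1))"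
      using coeff_le[OF n] by (intro sum_mono) (auto simp: A_def)
    also have "\<dots> \<le> (\<Sum>k=1..m. A * real k powr ((1 - \<alpha>) - 1))"
      using n that \<open>0 \<le> A\<close> by (intro sum_mono2) auto
    also have "\<dots> \<le> A * (real m powr (1 - \<alpha>) / (1 - \<alpha>))"
      unfolding sum_distrib_left[symmetric]
      using \<alpha> \<alpha>_pos \<open>0 \<le> A\<close> by (intro mult_left_mono sum_powr_le) auto
    also have "\<dots> \<le> A * ((1 / \<bar>t\<bar>) powr (1 - \<alpha>) / (1 - \<alpha>))"
      using \<alpha> m \<open>0 \<le> A\<close> by (intro mult_left_mono divide_right_mono powr_mono2) auto
    also have "(1 / \<bar>t\<bar>) powr (1 - \<alpha>) = \<bar>t\<bar> powr (\<alpha> - 1)"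
      using t powr_minus[of "\<bar>t\<bar>" "1 - \<alpha>"] by (simp add: powr_divide inverse_eq_divide)
    finally show ?thesis by simp
  qed
  have tail: "\<bar>block \<gamma> (Suc m) N t\<bar> \<le> A * \<bar>t\<bar> powr (\<alpha> - 1) * pi"
  proof -
    have "\<bar>block \<gamma> (Suc m) N t\<bar> \<le> a (Suc m) * (pi / \<bar>t\<bar>)"
      using t by (intro abs_block_le_inverse) auto
    also have "\<dots> \<le> A * real (Suc m) powr (- \<alpha>) * (pi / \<bar>t\<bar>)"
      unfolding A_def using \<open>n \<le> m\<close> by (intro mult_right_mono coeff_le n) auto
    also have "\<dots> \<le> A * (1 / \<bar>t\<bar>) powr (- \<alpha>) * (pi / \<bar>t\<bar>)"
      using m t \<alpha>_pos \<open>0 \<le> A\<close> by (intro mult_right_mono mult_left_mono powr_mono2') auto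
    also have "(1 / \<bar>t\<bar>) powr (- \<alpha>) = \<bar>t\<bar> powr \<alpha>"
      using t by (simp add: powr_divide powr_minus)
    also have "A * \<bar>t\<bar> powr \<alpha> * (pi / \<bar>t\<bar>) = A * \<bar>t\<bar> powr (\<alpha> - 1) * pi"
      using t by (simp add: powr_diff)
    finally show ?thesis .
  qed
  have "\<bar>block \<gamma> n N t\<bar> \<le> A * \<bar>t\<bar> powr (\<alpha> - 1) / (1 - \<alpha>) + A * \<bar>t\<bar> powr (\<alpha> - 1) * pi"
  proof (cases "N \<le> Suc m")
    case True
    have "0 \<le> A * \<bar>t\<bar> powr (\<alpha> - 1) * pi"
      using \<open>0 \<le> A\<close> by simp
    then show ?thesis
      using head[OF True] by linarith
  next
    case False
    have "block \<gamma> n N t = block \<gamma> n (Suc m) t + block \<gamma> (Suc m) N t"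
      unfolding block_def using False \<open>n \<le> m\<close> by (subst sum.atLeastLessThan_concat) auto
    then show ?thesis
      using head[of "Suc m"] tail by linarith
  qed
  also have "\<dots> = block_const * a n * envelope n t"
    using True by (simp add: envelope_def block_const_def A_def algebra_simps)
  finally show ?thesis .
qed

end

section \<open>Remainders of the convolution kernel\<close>

lemma integral_period_cos:
  "(LINT t|period. cos (of_int j * t + b)) = (if j = 0 then 2 * pi * cos b else 0)"
proof (cases "j = 0")
  case True
  have "measure period {-pi..pi} = 2 * pi"
    unfolding period_def by (subst measure_restrict_space) auto
  then show ?thesis
    using True by (simp add: mult.commute)
next
  case False
  define F where "F t = sin (of_int j * t + b) / of_int j" for t
  have "(LINT t|period. cos (of_int j * t + b)) = (LBINT t=-pi..pi. cos (of_int j * t + b))"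
    by (simp add: int_pi_eq[symmetric] int_pi_def interval_integral_Icc)
  also have "\<dots> = F pi - F (-pi)"
    by (rule interval_integral_FTC_finite)
       (use False in \<open>auto intro!: continuous_intros derivative_eq_intros
          simp: F_def has_real_derivative_iff_has_vector_derivative[symmetric]\<close>)
  also have "sin (of_int j * pi + b) = sin (of_int j * (-pi) + b)"
  proof -
    have "sin (of_int j * pi + b) = sin (of_int j * (-pi) + b + 2 * pi * of_int j)"
      by (simp add: algebra_simps)
    also have "\<dots> = sin (of_int j * (-pi) + b)"
      by (rule periodic_int_shift[where g = sin]) simp
    finally show ?thesis .
  qed
  then have "F pi - F (-pi) = 0"
    by (simp add: F_def)
  finally show ?thesis using False by simp
qed

lemma integrable_period_cos [simp]: "integrable period (\<lambda>t. cos (c * t + b))"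
  by (rule integrable_period_mult_cos[of "\<lambda>_. 1", simplified])

text \<open>After the product formula only frequency 0 contributes. As \<open>k\<close> is positive,
  \<open>k + m\<close> is never 0, and \<open>k - m\<close> is 0 only on the diagonal.\<close>

lemma integral_period_cos_mult_cos:
  assumes "1 \<le> k"
  shows "(LINT t|period. cos (real k * t - \<gamma>) * cos (real m * t + b)) = (if k = m then pi * cos (\<gamma> + b) else 0)"
proof -
  have "cos (real k * t - \<gamma>) * cos (real m * t + b)
     = (cos (of_int (int k - int m) * t + (-\<gamma> - b)) + cos (of_int (int k + int m) * t + (b - \<gamma>))) / 2" for t
    by (simp add: cos_times_cos algebra_simps)
  then have "(LINT t|period. cos (real k * t - \<gamma>) * cos (real m * t + b))
     = (LINT t|period. (cos (of_int (int k - int m) * t + (-\<gamma> - b)) + cos (of_int (int k + int m) * t + (b - \<gamma>))) / 2)"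
    by (simp only:)
  also have "\<dots> = ((LINT t|period. cos (of_int (int k - int m) * t + (-\<gamma> - b)))
      + (LINT t|period. cos (of_int (int k + int m) * t + (b - \<gamma>)))) / 2"
    by (subst integral_divide_zero, subst Bochner_Integration.integral_add)
       (simp_all only: integrable_period_cos)
  also have "\<dots> = (if k = m then pi * cos (\<gamma> + b) else 0)"
    unfolding integral_period_cos using assms cos_minus[of "\<gamma> + b"] by (auto simp del: cos_minus)
  finally show ?thesis .
qed

section \<open>The envelope in L_q and the kernel as a pointwise convergent series\<close>

context decaying_coeffs
begin

definition q :: real where
  "q = p / (p - 1)"

text \<open>The fourth fact is where 1/p < \<alpha> enters: it makes |t|^((\<alpha>-1)q) integrable
  at 0.\<close>

lemma q: "1 < q" "1/p + 1/q = 1" "(q - 1) / q = 1/p" "-1 < (\<alpha> - 1) * q" "q / p = q - 1"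
  using p \<alpha> by (auto simp: q_def field_simps)

definition envelope_const :: real where
  "envelope_const = 2 * (1 / ((\<alpha> - 1) * q + 1) + 1 / (q - 1))"

lemma envelope_const_pos: "0 < envelope_const"
  using q by (auto simp: envelope_const_def intro!: add_pos_pos mult_pos_pos)

lemma envelope_nonneg [simp]: "0 \<le> envelope n t"
  by (simp add: envelope_def)

lemma envelope_measurable [measurable]: "envelope n \<in> borel_measurable borel"
  unfolding envelope_def by measurable

text \<open>Both branches integrate explicitly on a half-line, and both integrals scale like
  n^(q-1). The whole line can serve as domain because |t|^(-q) is integrable at infinity.\<close>

lemma nn_integral_envelope_le:
  assumes "1 \<le> n"
  shows "(\<integral>\<^sup>+t. ennreal (envelope n t powr q) \<partial>lborel) \<le> ennreal (envelope_const * real n powr (q - 1))"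
proof -
  define c where "c = 1 / real n"
  have c: "0 < c" using assms by (simp add: c_def)
  \<comment> \<open>\<open>f\<close> lives on the nonnegative half-line; both branches count at
    \<open>c\<close>, which is harmless for an upper bound.\<close>
  define f where "f t = (if t \<in> {0..c} then real n powr (\<alpha> * q) * t powr ((\<alpha> - 1) * q) else 0)
      + (if t \<in> {c..} then t powr (-q) else 0)" for t :: real
  define I where "I = real n powr (\<alpha> * q) * (c powr ((\<alpha> - 1) * q + 1) / ((\<alpha> - 1) * q + 1))
      + (- (c powr (-q + 1)) / (-q + 1))"
  have f_nonneg: "0 \<le> f t" for t
    by (simp add: f_def)
  have [measurable]: "f \<in> borel_measurable borel"
    unfolding f_def by measurable
  have "(f has_integral I) UNIV"
    unfolding f_def I_def
  proof (intro has_integral_add)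
    show "((\<lambda>t. if t \<in> {0..c} then real n powr (\<alpha> * q) * t powr ((\<alpha> - 1) * q) else 0) has_integral
       real n powr (\<alpha> * q) * (c powr ((\<alpha> - 1) * q + 1) / ((\<alpha> - 1) * q + 1))) UNIV"
      unfolding has_integral_restrict_UNIV
      using q c by (intro has_integral_mult_right has_integral_powr_from_0) auto
    show "((\<lambda>t. if t \<in> {c..} then t powr (-q) else 0) has_integral (- (c powr (-q + 1)) / (-q + 1))) UNIV"
      unfolding has_integral_restrict_UNIV
      using q c by (intro has_integral_powr_to_inf) auto
  qed
  then have int_f: "(\<integral>\<^sup>+t. ennreal (f t) \<partial>lborel) = ennreal I"
    by (intro nn_integral_has_integral_lborel f_nonneg) auto
  have "I = real n powr (q - 1) * (1 / ((\<alpha> - 1) * q + 1) + 1 / (q - 1))"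
  proof -
    have "real n powr (\<alpha> * q) * c powr ((\<alpha> - 1) * q + 1) = real n powr (q - 1)"
      using assms by (simp add: c_def powr_divide powr_diff[symmetric]) (simp add: algebra_simps)
    moreover have "c powr (-q + 1) = real n powr (q - 1)"
      using assms powr_minus_divide[of "real n" "1 - q"] by (simp add: c_def powr_divide)
    moreover have "- x / (-q + 1) = x / (q - 1)" for x
      by (metis minus_diff_eq minus_divide_divide uminus_add_conv_diff)
    ultimately show ?thesis
      by (simp add: I_def distrib_left)
  qed
  then have I: "I + I = envelope_const * real n powr (q - 1)"
    by (simp add: envelope_const_def)
  have "0 \<le> I"
    using \<open>(f has_integral I) UNIV\<close> f_nonneg by (rule has_integral_nonneg)
  have env: "envelope n t powr q \<le> f t + f (- t)" for t
  proof -
    have "envelope n t powr q = (if \<bar>t\<bar> \<le> c then real n powr (\<alpha> * q) * \<bar>t\<bar> powr ((\<alpha> - 1) * q) else \<bar>t\<bar> powr (-q))"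
      by (simp add: envelope_def c_def powr_mult powr_powr powr_divide powr_minus_divide)
    also have "\<dots> \<le> f \<bar>t\<bar>"
      using c by (auto simp: f_def)
    also have "\<dots> \<le> f t + f (- t)"
      using f_nonneg[of t] f_nonneg[of "- t"] by (cases "t \<ge> 0") auto
    finally show ?thesis .
  qed
  have "(\<integral>\<^sup>+t. ennreal (envelope n t powr q) \<partial>lborel) \<le> (\<integral>\<^sup>+t. ennreal (f t) + ennreal (f (- t)) \<partial>lborel)"
    using env f_nonneg by (intro nn_integral_mono) (simp add: ennreal_plus[symmetric] del: ennreal_plus)
  also have "\<dots> = (\<integral>\<^sup>+t. ennreal (f t) \<partial>lborel) + (\<integral>\<^sup>+t. ennreal (f (- t)) \<partial>lborel)"
    by (rule nn_integral_add) auto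
  also have "(\<integral>\<^sup>+t. ennreal (f (- t)) \<partial>lborel) = (\<integral>\<^sup>+t. ennreal (f t) \<partial>lborel)"
    by (subst (2) nn_integral_real_affine[where c = "-1" and t = 0]) auto
  also have "(\<integral>\<^sup>+t. ennreal (f t) \<partial>lborel) + (\<integral>\<^sup>+t. ennreal (f t) \<partial>lborel) = ennreal (I + I)"
    unfolding int_f by (rule ennreal_plus[symmetric]) fact+
  finally show ?thesis
    unfolding I .
qed

lemma nn_integral_period_envelope_le:
  assumes "1 \<le> n"
  shows "(\<integral>\<^sup>+t. ennreal (envelope n t powr q) \<partial>period) \<le> ennreal (envelope_const * real n powr (q - 1))"
proof -
  have "(\<integral>\<^sup>+t. ennreal (envelope n t powr q) \<partial>period) \<le> (\<integral>\<^sup>+t. ennreal (envelope n t powr q) \<partial>lborel)"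
    unfolding nn_integral_period by (intro nn_integral_mono) (auto split: split_indicator)
  also note nn_integral_envelope_le[OF assms]
  finally show ?thesis .
qed

text \<open>On a finite measure L_q is contained in L_1, here through x <= 1 + x^q.\<close>

lemma integrable_envelope: "integrable period (envelope 1)"
proof (rule Bochner_Integration.integrable_bound)
  have "(\<integral>\<^sup>+t. ennreal (envelope 1 t powr q) \<partial>period) < \<infinity>"
    using nn_integral_period_envelope_le[of 1] by (auto simp: top.extremum_strict intro: le_less_trans)
  then have "integrable period (\<lambda>t. envelope 1 t powr q)"
    by (intro integrableI_nonneg) auto
  then show "integrable period (\<lambda>t. 1 + envelope 1 t powr q)"
    by simp
  have "envelope 1 t \<le> 1 + envelope 1 t powr q" for t
  proof (cases "envelope 1 t \<le> 1")
    case False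
    then have "envelope 1 t powr 1 \<le> envelope 1 t powr q"
      using q by (intro powr_mono) auto
    then show ?thesis using False by simp
  qed (simp add: add_increasing2)
  then show "AE t in period. norm (envelope 1 t) \<le> norm (1 + envelope 1 t powr q)"
    by (auto simp: abs_of_nonneg add_nonneg_nonneg)
qed measurable

text \<open>At multiples of \<open>2\<pi>\<close> the series may diverge and \<open>suminf\<close> returns an arbitrary value.\<close>
definition series :: "real \<Rightarrow> real \<Rightarrow> real" where
  "series \<gamma> t = (\<Sum>k. a (Suc k) * cos (real (Suc k) * t - \<gamma>))"

lemma coeff_tendsto_0: "a \<longlonglongrightarrow> 0"
proof (rule tendsto_sandwich[where f = "\<lambda>_. 0"])
  show "(\<lambda>n. K * a 1 * real 1 powr \<alpha> * real n powr (- \<alpha>)) \<longlonglongrightarrow> 0"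
    using \<alpha>_pos by (intro tendsto_mult_right_zero tendsto_neg_powr filterlim_real_sequentially)
      simp
  show "eventually (\<lambda>n. a n \<le> K * a 1 * real 1 powr \<alpha> * real n powr (- \<alpha>)) sequentially"
    using eventually_ge_at_top[of 1] by eventually_elim (rule coeff_le; simp)
  show "eventually (\<lambda>n. 0 \<le> a n) sequentially"
    using eventually_ge_at_top[of 1] by eventually_elim (simp add: pos less_imp_le)
qed auto

lemma block_measurable [measurable]: "block \<gamma> n N \<in> borel_measurable borel"
  unfolding block_def by measurable

lemma block_diff: "1 \<le> n \<Longrightarrow> n \<le> N \<Longrightarrow> block \<gamma> 1 N t - block \<gamma> 1 n t = block \<gamma> n N t"
  unfolding block_def by (subst sum.atLeastLessThan_concat[symmetric, of 1 n N]) auto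

text \<open>Convergence is obtained from cancellation: by Abel summation a block from
  \<open>m\<close> on is at most a constant multiple of \<open>a m\<close>, which tends to
  0.\<close>

lemma block_tendsto_series:
  assumes "t \<noteq> 0" "\<bar>t\<bar> \<le> pi"
  shows "(\<lambda>N. block \<gamma> 1 N t) \<longlonglongrightarrow> series \<gamma> t"
proof -
  have "Cauchy (\<lambda>N. block \<gamma> 1 N t)"
  proof (rule CauchyI')
    fix e :: real assume "e > 0"
    then have "eventually (\<lambda>n. a n * (pi / \<bar>t\<bar>) < e) sequentially"
      using tendsto_mult_left_zero[OF coeff_tendsto_0, of "pi / \<bar>t\<bar>"] order_tendstoD(2) by blast
    then obtain M where M: "\<And>n. n \<ge> M \<Longrightarrow> a n * (pi / \<bar>t\<bar>) < e"
      by (auto simp: eventually_sequentially)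
    show "\<exists>M. \<forall>m\<ge>M. \<forall>n>m. dist (block \<gamma> 1 m t) (block \<gamma> 1 n t) < e"
    proof (intro exI[of _ "max 1 M"] allI impI)
      fix m n assume "max 1 M \<le> m" "m < n"
      then show "dist (block \<gamma> 1 m t) (block \<gamma> 1 n t) < e"
        using abs_block_le_inverse[of m t \<gamma> n] M[of m] assms block_diff[of m n \<gamma> t]
        by (simp add: dist_real_def abs_minus_commute)
    qed
  qed
  then have conv: "convergent (\<lambda>N. block \<gamma> 1 N t)"
    by (rule Cauchy_convergent)
  \<comment> \<open>Blocks are indexed from 1 and the series from 0, hence the shift by one.\<close>
  have eq: "block \<gamma> 1 (Suc N) t = (\<Sum>k<N. a (Suc k) * cos (real (Suc k) * t - \<gamma>))" for N
    unfolding block_def by (simp add: sum.shift_bounds_Suc_ivl lessThan_atLeast0 del: sum.op_ivl_Suc of_nat_Suc)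
  have "convergent (\<lambda>N. block \<gamma> 1 (Suc N) t)"
    using conv by (subst convergent_Suc_iff)
  then have "summable (\<lambda>k. a (Suc k) * cos (real (Suc k) * t - \<gamma>))"
    by (simp only: eq summable_iff_convergent)
  then have "(\<lambda>N. block \<gamma> 1 (Suc N) t) \<longlonglongrightarrow> series \<gamma> t"
    unfolding eq series_def by (rule summable_LIMSEQ)
  then show ?thesis
    by (rule LIMSEQ_imp_Suc)
qed

lemma abs_series_diff_block_le:
  assumes "1 \<le> n" "t \<noteq> 0" "\<bar>t\<bar> \<le> pi"
  shows "\<bar>series \<gamma> t - block \<gamma> 1 n t\<bar> \<le> block_const * a n * envelope n t"
proof (rule LIMSEQ_le_const2)
  show "(\<lambda>N. \<bar>block \<gamma> 1 N t - block \<gamma> 1 n t\<bar>) \<longlonglongrightarrow> \<bar>series \<gamma> t - block \<gamma> 1 n t\<bar>"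
    using assms by (intro tendsto_intros block_tendsto_series)
  show "\<exists>N. \<forall>m\<ge>N. \<bar>block \<gamma> 1 m t - block \<gamma> 1 n t\<bar> \<le> block_const * a n * envelope n t"
    using abs_block_le_envelope[OF assms] by (intro exI[of _ n] allI impI) (simp only: block_diff[OF assms(1)])
qed

lemma AE_period_nonzero: "AE t in period. t \<noteq> 0 \<and> \<bar>t\<bar> \<le> pi"
proof -
  have "AE t in period. t \<in> space period"
    by (rule AE_space)
  with AE_period[OF AE_lborel_singleton[of 0]] show ?thesis
    by eventually_elim auto
qed

lemma series_measurable [measurable]: "series \<gamma> \<in> borel_measurable borel"
  unfolding series_def by measurable

text \<open>Termwise integration is legitimate because all partial sums are dominated by a multiple
  of \<open>envelope 1\<close>, which is integrable.\<close>

lemma integral_series_mult_cos: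
  shows "integrable period (series \<gamma>)"
    and "(LINT t|period. series \<gamma> t * cos (real m * t + b)) = (if m = 0 then 0 else pi * a m * cos (\<gamma> + b))"
proof -
  define w where "w t = block_const * a 1 * envelope 1 t" for t
  have w: "integrable period w"
    unfolding w_def using integrable_envelope by simp
  have bound: "\<bar>block \<gamma> 1 N t\<bar> \<le> w t" if "t \<noteq> 0 \<and> \<bar>t\<bar> \<le> pi" for N t
    using abs_block_le_envelope[of 1 t] that by (simp add: w_def)
  have "AE t in period. norm (series \<gamma> t) \<le> w t"
    using AE_period_nonzero
  proof eventually_elim
    case (elim t)
    \<comment> \<open>The block from 1 to 1 is empty, so the remainder bound with n = 1 bounds the
      series itself.\<close>
    then show ?case
      using abs_series_diff_block_le[of 1 t \<gamma>] by (simp add: w_def block_def)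
  qed
  then show "integrable period (series \<gamma>)"
    by (intro Bochner_Integration.integrable_bound[OF w]) auto
  have "(\<lambda>N. LINT t|period. block \<gamma> 1 N t * cos (real m * t + b))
      \<longlonglongrightarrow> (LINT t|period. series \<gamma> t * cos (real m * t + b))"
  proof (rule integral_dominated_convergence[OF _ _ w])
    show "AE t in period. (\<lambda>N. block \<gamma> 1 N t * cos (real m * t + b)) \<longlonglongrightarrow> series \<gamma> t * cos (real m * t + b)"
      using AE_period_nonzero by eventually_elim (intro tendsto_mult block_tendsto_series tendsto_const; simp)
    show "AE t in period. norm (block \<gamma> 1 N t * cos (real m * t + b)) \<le> w t" for N
      using AE_period_nonzero
    proof eventually_elim
      case (elim t)
      have "\<bar>block \<gamma> 1 N t * cos (real m * t + b)\<bar> \<le> \<bar>block \<gamma> 1 N t\<bar>"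
        by (simp add: abs_mult mult_left_le)
      then show ?case
        using bound[OF elim, of N] by simp
    qed
  qed measurable
  \<comment> \<open>Once \<open>N\<close> exceeds \<open>m\<close> the integral no longer changes
    with \<open>N\<close>.\<close>
  moreover have "(LINT t|period. block \<gamma> 1 N t * cos (real m * t + b)) = (if m = 0 then 0 else pi * a m * cos (\<gamma> + b))"
    if "m < N" for N
  proof -
    have "(LINT t|period. block \<gamma> 1 N t * cos (real m * t + b))
        = (\<Sum>k=1..<N. LINT t|period. a k * (cos (real k * t - \<gamma>) * cos (real m * t + b)))"
      unfolding block_def sum_distrib_right mult.assoc
      using integrable_period_mult_cos[OF integrable_period_cos[of "real _" "- \<gamma>"], of _ "real m" b]
      by (intro Bochner_Integration.integral_sum) simp
    also have "\<dots> = (\<Sum>k=1..<N. a k * (if k = m then pi * cos (\<gamma> + b) else 0))"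
      by (intro sum.cong refl) (simp add: integral_period_cos_mult_cos del: mult_eq_0_iff)
    also have "\<dots> = (\<Sum>k=1..<N. if k = m then a m * (pi * cos (\<gamma> + b)) else 0)"
      by (intro sum.cong refl) simp
    also have "\<dots> = (if m = 0 then 0 else pi * a m * cos (\<gamma> + b))"
      using that by (simp add: sum.delta)
    finally show ?thesis .
  qed
  then have "(\<lambda>N. LINT t|period. block \<gamma> 1 N t * cos (real m * t + b))
      \<longlonglongrightarrow> (if m = 0 then 0 else pi * a m * cos (\<gamma> + b))"
    by (intro tendsto_eventually eventually_mono[OF eventually_gt_at_top[of m]])
  ultimately show "(LINT t|period. series \<gamma> t * cos (real m * t + b)) = (if m = 0 then 0 else pi * a m * cos (\<gamma> + b))"
    by (rule LIMSEQ_unique)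
qed

text \<open>\<open>\<Psi>\<close> has the Fourier series \<open>\<Sum>k\<ge>1. a k * cos (k t - \<gamma>)\<close>; the phase \<open>b\<close> covers cosine and sine
  coefficients at once.\<close>
definition kernel :: "real \<Rightarrow> (real \<Rightarrow> real) \<Rightarrow> bool" where
  "kernel \<gamma> \<Psi> \<longleftrightarrow> (\<forall>t. \<Psi> (t + 2*pi) = \<Psi> t) \<and> \<Psi> \<in> borel_measurable borel \<and> integrable period \<Psi> \<and>
     (\<forall>m b. (LINT t|period. \<Psi> t * cos (real m * t + b)) = (if m = 0 then 0 else pi * a m * cos (\<gamma> + b)))"

text \<open>Equal Fourier coefficients force equality almost everywhere, so the pointwise estimates
  for the series pass to any representative of the kernel.\<close>

lemma kernel_eq_series:
  assumes "kernel \<gamma> \<Psi>"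
  shows "AE t in period. \<Psi> t = series \<gamma> t"
proof -
  have \<Psi>: "integrable period \<Psi>"
    and coeffs: "\<And>m b. (LINT t|period. \<Psi> t * cos (real m * t + b)) = (if m = 0 then 0 else pi * a m * cos (\<gamma> + b))"
    using assms by (auto simp: kernel_def)
  have zero: "(LINT t|period. (\<Psi> t - series \<gamma> t) * cos (real m * t + b)) = 0" for m b
    using \<Psi> integral_series_mult_cos(1)
    by (simp add: left_diff_distrib coeffs integral_series_mult_cos)
  have "AE t in lborel. t \<in> {-pi..pi} \<longrightarrow> \<Psi> t - series \<gamma> t = 0"
  proof (rule fourier_uniqueness)
    show "integrable period (\<lambda>t. \<Psi> t - series \<gamma> t)"
      using \<Psi> integral_series_mult_cos(1) by simp
    show "(LINT t|period. (\<Psi> t - series \<gamma> t) * cos (real k * t)) = 0" for k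
      using zero[of k 0] by simp
    show "(LINT t|period. (\<Psi> t - series \<gamma> t) * sin (real k * t)) = 0" for k
      using zero[of k "- pi/2"] by (simp add: cos_diff)
  qed
  then show ?thesis
    unfolding period_def by (subst AE_restrict_space_iff) auto
qed

definition deviation_const :: real where
  "deviation_const = block_const * envelope_const powr (1/q)"

lemma deviation_const_pos: "0 < deviation_const"
  using block_const_pos envelope_const_pos by (simp add: deviation_const_def)

text \<open>The L_q bound for the remainder, kept in q-th powers to fit the hypothesis of
  \<open>holder_inequality\<close>. The block removes the frequencies 1 to n - 1.\<close>

lemma nn_integral_kernel_diff_block_le:
  assumes "kernel \<gamma> \<Psi>" "1 \<le> n"
  shows "(\<integral>\<^sup>+t. ennreal (\<bar>\<Psi> t - block \<gamma> 1 n t\<bar> powr q) \<partial>period)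
    \<le> ennreal ((deviation_const * a n * real n powr (1/p)) powr q)"
proof -
  have an: "0 < a n" using pos assms by simp
  have "(\<integral>\<^sup>+t. ennreal (\<bar>\<Psi> t - block \<gamma> 1 n t\<bar> powr q) \<partial>period)
      \<le> (\<integral>\<^sup>+t. ennreal ((block_const * a n) powr q) * ennreal (envelope n t powr q) \<partial>period)"
  proof (rule nn_integral_mono_AE)
    show "AE t in period. ennreal (\<bar>\<Psi> t - block \<gamma> 1 n t\<bar> powr q)
        \<le> ennreal ((block_const * a n) powr q) * ennreal (envelope n t powr q)"
      using kernel_eq_series[OF assms(1)] AE_period_nonzero
    proof eventually_elim
      case (elim t)
      then have "\<bar>\<Psi> t - block \<gamma> 1 n t\<bar> powr q \<le> (block_const * a n * envelope n t) powr q"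
        using abs_series_diff_block_le[OF assms(2), of t \<gamma>] q by (intro powr_mono2) auto
      also have "\<dots> = (block_const * a n) powr q * envelope n t powr q"
        by (rule powr_mult)
      finally show ?case
        by (simp add: ennreal_mult[symmetric])
    qed
  qed
  also have "\<dots> = ennreal ((block_const * a n) powr q) * (\<integral>\<^sup>+t. ennreal (envelope n t powr q) \<partial>period)"
    by (rule nn_integral_cmult) measurable
  also have "\<dots> \<le> ennreal ((block_const * a n) powr q) * ennreal (envelope_const * real n powr (q - 1))"
    by (intro mult_left_mono nn_integral_period_envelope_le assms) auto
  also have "\<dots> = ennreal ((deviation_const * a n * real n powr (1/p)) powr q)"
  proof -
    have "(deviation_const * a n * real n powr (1/p)) powr q
        = (block_const * a n) powr q * (envelope_const powr (1/q)) powr q * (real n powr ((q - 1)/q)) powr q"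
      unfolding deviation_const_def q(3)[symmetric]
      using block_const_pos an by (simp add: powr_mult mult_ac)
    also have "\<dots> = (block_const * a n) powr q * (envelope_const * real n powr (q - 1))"
      using q envelope_const_pos by (simp add: powr_powr)
    finally show ?thesis
      using envelope_const_pos by (simp add: ennreal_mult)
  qed
  finally show ?thesis .
qed

end

section \<open>The upper bound\<close>

text \<open>Young's inequality for |g| and |f|/A, multiplied by \<open>A\<close> and integrated. It
  also provides integrability of the product, which the convolutions need.\<close>

lemma holder_inequality:
  fixes f g :: "'a \<Rightarrow> real"
  assumes pq: "1 < p" "1 < q" "1/p + 1/q = 1" and "0 < A"
    and [measurable]: "f \<in> borel_measurable M" "g \<in> borel_measurable M"
    and f: "(\<integral>\<^sup>+t. ennreal (\<bar>f t\<bar> powr q) \<partial>M) \<le> ennreal (A powr q)"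
    and g: "(\<integral>\<^sup>+t. ennreal (\<bar>g t\<bar> powr p) \<partial>M) \<le> 1"
  shows "integrable M (\<lambda>t. f t * g t)" "\<bar>LINT t|M. f t * g t\<bar> \<le> A"
proof -
  \<comment> \<open>The factor of |f|^q in A (|f|/A)^q / q; the two integrated terms then add up to
    A/q + A/p = A.\<close>
  define B where "B = A powr (1 - q) / q"
  have "0 \<le> B"
    using pq by (simp add: B_def)
  have young: "\<bar>f t * g t\<bar> \<le> B * \<bar>f t\<bar> powr q + A / p * \<bar>g t\<bar> powr p" for t
  proof -
    have "\<bar>g t\<bar> * (\<bar>f t\<bar> / A) \<le> \<bar>g t\<bar> powr p / p + (\<bar>f t\<bar> / A) powr q / q"
      using pq \<open>0 < A\<close> by (intro Youngs_inequality) auto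
    then have "A * (\<bar>g t\<bar> * (\<bar>f t\<bar> / A)) \<le> A * (\<bar>g t\<bar> powr p / p + (\<bar>f t\<bar> / A) powr q / q)"
      using \<open>0 < A\<close> by (intro mult_left_mono) auto
    moreover have "A * (\<bar>g t\<bar> * (\<bar>f t\<bar> / A)) = \<bar>f t * g t\<bar>"
      using \<open>0 < A\<close> by (simp add: abs_mult)
    moreover have "A * ((\<bar>f t\<bar> / A) powr q / q) = B * \<bar>f t\<bar> powr q"
      using \<open>0 < A\<close> by (simp add: B_def powr_divide powr_diff)
    ultimately show ?thesis
      by (simp add: distrib_left)
  qed
  have "(\<integral>\<^sup>+t. ennreal (norm (f t * g t)) \<partial>M)
      \<le> (\<integral>\<^sup>+t. ennreal B * ennreal (\<bar>f t\<bar> powr q) + ennreal (A / p) * ennreal (\<bar>g t\<bar> powr p) \<partial>M)"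
  proof (rule nn_integral_mono)
    fix t
    have "ennreal (norm (f t * g t)) \<le> ennreal (B * \<bar>f t\<bar> powr q + A / p * \<bar>g t\<bar> powr p)"
      using young by (intro ennreal_leI) simp
    also have "\<dots> = ennreal B * ennreal (\<bar>f t\<bar> powr q) + ennreal (A / p) * ennreal (\<bar>g t\<bar> powr p)"
      using \<open>0 \<le> B\<close> \<open>0 < A\<close> pq
      by (simp add: ennreal_mult[symmetric] ennreal_plus[symmetric] del: ennreal_plus)
    finally show "ennreal (norm (f t * g t)) \<le> \<dots>" .
  qed
  also have "\<dots> = ennreal B * (\<integral>\<^sup>+t. ennreal (\<bar>f t\<bar> powr q) \<partial>M) + ennreal (A / p) * (\<integral>\<^sup>+t. ennreal (\<bar>g t\<bar> powr p) \<partial>M)"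
    by (simp add: nn_integral_add nn_integral_cmult)
  also have "\<dots> \<le> ennreal B * ennreal (A powr q) + ennreal (A / p) * 1"
    by (intro add_mono mult_left_mono f g) auto
  also have "\<dots> = ennreal (B * A powr q + A / p)"
    using \<open>0 \<le> B\<close> \<open>0 < A\<close> pq
    by (simp add: ennreal_mult[symmetric] ennreal_plus[symmetric] del: ennreal_plus)
  also have "B * A powr q + A / p = A * (1/p + 1/q)"
    using \<open>0 < A\<close> by (simp add: B_def powr_diff distrib_left)
  also have "\<dots> = A"
    using pq by simp
  finally have le: "(\<integral>\<^sup>+t. ennreal (norm (f t * g t)) \<partial>M) \<le> ennreal A" .
  then show int: "integrable M (\<lambda>t. f t * g t)"
    by (intro integrableI_bounded) (auto intro: le_less_trans)
  have "ennreal (norm (LINT t|M. f t * g t)) \<le> ennreal A"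
    using integral_norm_bound_ennreal[OF int] le by (rule order_trans)
  then show "\<bar>LINT t|M. f t * g t\<bar> \<le> A"
    using \<open>0 < A\<close> by simp
qed

text \<open>The set where the bound fails is open and null, hence empty. This turns the
  almost-everywhere representation in \<open>C_class\<close> into estimates at every point.\<close>

lemma AE_bound_continuous:
  fixes g :: "real \<Rightarrow> real"
  assumes "continuous_on UNIV g" "AE x in lborel. \<bar>g x\<bar> \<le> D"
  shows "\<bar>g x\<bar> \<le> D"
proof (rule ccontr)
  assume "\<not> \<bar>g x\<bar> \<le> D"
  define U where "U = {x. D < \<bar>g x\<bar>}"
  have "open U"
    unfolding U_def using assms(1) by (intro open_Collect_less continuous_intros)
  moreover have "x \<in> U"
    using \<open>\<not> \<bar>g x\<bar> \<le> D\<close> by (simp add: U_def)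
  moreover have "U \<in> null_sets lborel"
  proof -
    have "{x \<in> space lborel. \<not> \<bar>g x\<bar> \<le> D} = U"
      by (auto simp: U_def)
    then show ?thesis
      using assms(2) \<open>open U\<close> by (subst (asm) AE_iff_null) (auto simp: borel_open)
  qed
  then have "negligible U"
    by (simp add: negligible_iff_null_sets null_sets_completionI)
  ultimately show False
    using open_not_negligible by blast
qed

text \<open>A real-valued supremum such as \<open>supnorm\<close> is meaningful only for a bounded
  range; compactness of one period provides this.\<close>

lemma periodic_continuous_bounded:
  fixes h :: "real \<Rightarrow> real"
  assumes "continuous_on UNIV h" and per: "\<And>x. h (x + 2*pi) = h x"
  shows "bdd_above (range (\<lambda>x. \<bar>h x\<bar>))"
proof -
  have "compact (h ` {0..2*pi})"
    by (intro compact_continuous_image continuous_on_subset[OF assms(1)]) auto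
  then obtain B where B: "\<bar>h x\<bar> \<le> B" if "x \<in> {0..2*pi}" for x
    using that by (force dest!: compact_imp_bounded simp: bounded_iff)
  have "\<bar>h x\<bar> \<le> B" for x
  proof -
    define m where "m = \<lfloor>x / (2*pi)\<rfloor>"
    have "of_int m \<le> x / (2*pi)" "x / (2*pi) < of_int m + 1"
      unfolding m_def by linarith+
    then have "x - 2*pi * of_int m \<in> {0..2*pi}"
      by (simp add: field_simps)
    then show ?thesis
      using B[of "x - 2*pi * of_int m"] periodic_int_shift[where g = h, OF per, of "x - 2*pi * of_int m" m]
      by simp
  qed
  then show ?thesis
    by (intro bdd_aboveI[of _ B]) auto
qed

lemma cos_frequency_periodic: "cos (real k * (x + 2*pi) + b) = cos (real k * x + b)"
  and sin_frequency_periodic: "sin (real k * (x + 2*pi) + b) = sin (real k * x + b)"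
proof -
  have "real k * (x + 2*pi) + b = real k * x + b + 2*pi * of_int (int k)"
    by (simp add: algebra_simps)
  then show "cos (real k * (x + 2*pi) + b) = cos (real k * x + b)"
    "sin (real k * (x + 2*pi) + b) = sin (real k * x + b)"
    by (simp_all only: periodic_int_shift[where g = cos, OF cos_periodic]
        periodic_int_shift[where g = sin, OF sin_periodic])
qed

lemma trig_polys_periodic_continuous:
  assumes "\<tau> \<in> trig_polys n"
  shows "\<tau> (x + 2*pi) = \<tau> x" "continuous_on UNIV \<tau>"
proof -
  obtain c a b where \<tau>: "\<tau> = (\<lambda>x. c + (\<Sum>k=1..<n. a k * cos (real k * x) + b k * sin (real k * x)))"
    using assms by (auto simp: trig_polys_def)
  have "cos (real k * (x + 2*pi)) = cos (real k * x)" "sin (real k * (x + 2*pi)) = sin (real k * x)" for k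
    using cos_frequency_periodic[of k x 0] sin_frequency_periodic[of k x 0] by simp_all
  then show "\<tau> (x + 2*pi) = \<tau> x"
    by (simp add: \<tau>)
  show "continuous_on UNIV \<tau>"
    unfolding \<tau> by (intro continuous_intros)
qed

lemma abs_le_supnorm_diff:
  assumes "continuous_on UNIV f" "periodic2pi f" "\<tau> \<in> trig_polys n"
  shows "\<bar>f x - \<tau> x\<bar> \<le> supnorm (\<lambda>x. f x - \<tau> x)"
  unfolding supnorm_def
proof (rule cSUP_upper)
  show "bdd_above (range (\<lambda>x. \<bar>f x - \<tau> x\<bar>))"
    using assms trig_polys_periodic_continuous[OF assms(3)]
    by (intro periodic_continuous_bounded continuous_intros) (auto simp: periodic2pi_def)
qed simp

lemma fourier_partial_sum_trig_poly:
  "1 \<le> n \<Longrightarrow> fourier_partial_sum (n - 1) f \<in> trig_polys n"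
proof -
  assume "1 \<le> n"
  then have "{1..n - 1} = {1..<n}" by auto
  then have "fourier_partial_sum (n - 1) f = (\<lambda>x. fourier_cos f 0 / 2
      + (\<Sum>k=1..<n. fourier_cos f k * cos (real k * x) + fourier_sin f k * sin (real k * x)))"
    by (simp add: fourier_partial_sum_def fun_eq_iff)
  then show ?thesis
    unfolding trig_polys_def by blast
qed

lemma best_approx_le_fourier_dev:
  assumes "1 \<le> n" and F: "\<And>f. f \<in> F \<Longrightarrow> continuous_on UNIV f \<and> periodic2pi f"
  shows "best_approx n F \<le> fourier_dev n F"
  unfolding best_approx_def fourier_dev_def
proof (rule SUP_mono)
  fix f assume f: "f \<in> F"
  have "(INF \<tau>\<in>trig_polys n. supnorm (\<lambda>x. f x - \<tau> x)) \<le> supnorm (\<lambda>x. f x - fourier_partial_sum (n - 1) f x)"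
  proof (rule cINF_lower)
    show "bdd_below ((\<lambda>\<tau>. supnorm (\<lambda>x. f x - \<tau> x)) ` trig_polys n)"
    proof (rule bdd_belowI2)
      fix \<tau> assume "\<tau> \<in> trig_polys n"
      then show "0 \<le> supnorm (\<lambda>x. f x - \<tau> x)"
        using F[OF f] by (intro order_trans[OF abs_ge_zero abs_le_supnorm_diff]) auto
    qed
  qed (rule fourier_partial_sum_trig_poly[OF assms(1)])
  then show "\<exists>g\<in>F. ereal (INF \<tau>\<in>trig_polys n. supnorm (\<lambda>x. f x - \<tau> x))
      \<le> ereal (supnorm (\<lambda>x. g x - fourier_partial_sum (n - 1) g x))"
    using f by auto
qed

lemma integral_trig_poly_mult_cos:
  assumes "k < N"
  shows "(LINT t|period. (c + (\<Sum>j=1..<N. A j * cos (real j * t) + B j * sin (real j * t))) * cos (real k * t + b))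
    = (if k = 0 then 2 * pi * c * cos b else pi * (A k * cos b - B k * sin b))"
proof -
  have const: "(LINT t|period. cos (real k * t + b)) = (if k = 0 then 2 * pi * cos b else 0)"
    using integral_period_cos[of "int k" b] by simp
  have int: "integrable period (\<lambda>t. x * (cos (real j * t - y) * cos (real k * t + b)))" for j x y
    using integrable_period_mult_cos[OF integrable_period_cos[of "real j" "- y"], of "real k" b] by simp
  \<comment> \<open>Sines are written as cosines with phase \<open>pi/2\<close>, so that one
    orthogonality relation covers both.\<close>
  have "(c + (\<Sum>j=1..<N. A j * cos (real j * t) + B j * sin (real j * t))) * cos (real k * t + b)
     = c * cos (real k * t + b) + (\<Sum>j=1..<N. A j * (cos (real j * t - 0) * cos (real k * t + b))
        + B j * (cos (real j * t - pi/2) * cos (real k * t + b)))" for t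
    by (simp add: distrib_right sum_distrib_right cos_diff mult.assoc)
  then have "(LINT t|period. (c + (\<Sum>j=1..<N. A j * cos (real j * t) + B j * sin (real j * t))) * cos (real k * t + b))
     = (LINT t|period. c * cos (real k * t + b) + (\<Sum>j=1..<N. A j * (cos (real j * t - 0) * cos (real k * t + b))
        + B j * (cos (real j * t - pi/2) * cos (real k * t + b))))"
    by (simp only:)
  also have "\<dots> = c * (LINT t|period. cos (real k * t + b))
     + (\<Sum>j=1..<N. A j * (LINT t|period. cos (real j * t - 0) * cos (real k * t + b))
        + B j * (LINT t|period. cos (real j * t - pi/2) * cos (real k * t + b)))"
    using int by (simp only: Bochner_Integration.integral_add Bochner_Integration.integral_sum
        integral_mult_right_zero integrable_period_cos integrable_mult_right
        Bochner_Integration.integrable_add Bochner_Integration.integrable_sum)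
  also have "(\<Sum>j=1..<N. A j * (LINT t|period. cos (real j * t - 0) * cos (real k * t + b))
        + B j * (LINT t|period. cos (real j * t - pi/2) * cos (real k * t + b)))
      = (\<Sum>j=1..<N. if j = k then pi * (A k * cos b - B k * sin b) else 0)"
    by (intro sum.cong refl) (simp only: integral_period_cos_mult_cos atLeastLessThan_iff,
        auto simp: cos_add algebra_simps)
  also have "\<dots> = (if k = 0 then 0 else pi * (A k * cos b - B k * sin b))"
    using assms by (simp add: sum.delta)
  finally show ?thesis
    by (simp add: const)
qed

text \<open>The norm is defined over 0 to \<open>2*pi\<close> and is moved here to the symmetric
  period.\<close>

lemma Lp_ballD:
  assumes "\<phi> \<in> Lp_ball p"
  shows "\<phi> (t + 2*pi) = \<phi> t" "\<phi> \<in> borel_measurable borel" "(\<integral>\<^sup>+t. ennreal (\<bar>\<phi> t\<bar> powr p) \<partial>period) \<le> 1"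
proof -
  show meas [measurable]: "\<phi> \<in> borel_measurable borel"
    using assms by (simp add: Lp_ball_def)
  have per: "\<phi> (t + 2*pi) = \<phi> t" for t
    using assms by (simp add: Lp_ball_def periodic2pi_def)
  then show "\<phi> (t + 2*pi) = \<phi> t" .
  have "(\<integral>\<^sup>+t. ennreal (\<bar>\<phi> t\<bar> powr p) * indicator {0..0 + 2*pi} t \<partial>lborel) = (\<integral>\<^sup>+t. ennreal (\<bar>\<phi> t\<bar> powr p) \<partial>period)"
    by (rule nn_integral_periodic_interval) (auto simp: per)
  then show "(\<integral>\<^sup>+t. ennreal (\<bar>\<phi> t\<bar> powr p) \<partial>period) \<le> 1"
    using assms by (simp add: Lp_ball_def)
qed

section \<open>Approximation of the convolutions by trigonometric polynomials\<close>

context decaying_coeffs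
begin

lemma block_periodic: "block \<gamma> n N (t + 2*pi) = block \<gamma> n N t"
proof -
  have "cos (real k * (t + 2*pi) - \<gamma>) = cos (real k * t - \<gamma>)" for k
    using cos_frequency_periodic[of k t "- \<gamma>"] by simp
  then show ?thesis by (simp add: block_def)
qed

lemma integrable_Lp_ball:
  assumes "\<phi> \<in> Lp_ball p"
  shows "integrable period \<phi>"
proof -
  note [measurable] = Lp_ballD(2)[OF assms]
  have "integrable period (\<lambda>t. 1 * \<phi> t)"
  proof (rule holder_inequality(1)[OF p q(1,2)])
    show "0 < (2*pi) powr (1/q)" by simp
    have "emeasure period {-pi..pi} = ennreal (2*pi)"
      unfolding period_def by (subst emeasure_restrict_space) auto
    then show "(\<integral>\<^sup>+t. ennreal (\<bar>1\<bar> powr q) \<partial>period) \<le> ennreal (((2*pi) powr (1/q)) powr q)"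
      using q by (simp add: powr_powr)
  qed (use Lp_ballD[OF assms] in auto)
  then show ?thesis by simp
qed

text \<open>The first block of the kernel convolves to a trigonometric polynomial, and Hoelder's
  inequality bounds the contribution of the remainder. The coefficients are fixed before
  \<open>n\<close>, so the polynomials are partial sums of a single series and \<open>n\<close> may
  later tend to infinity.\<close>

lemma conv_kernel_approx:
  assumes \<Psi>: "kernel \<gamma> \<Psi>" and \<phi>: "\<phi> \<in> Lp_ball p"
  obtains A B where "\<And>n x. 1 \<le> n \<Longrightarrow>
    \<bar>conv_pi \<Psi> \<phi> x - (\<Sum>k=1..<n. A k * cos (real k * x) + B k * sin (real k * x))\<bar>
      \<le> deviation_const / pi * a n * real n powr (1/p)"
proof
  define A where "A k = a k / pi * (LINT t|period. \<phi> t * cos (real k * t + \<gamma>))" for k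
  define B where "B k = a k / pi * (LINT t|period. \<phi> t * sin (real k * t + \<gamma>))" for k
  fix n x assume n: "1 \<le> (n::nat)"
  note [measurable] = Lp_ballD(2)[OF \<phi>]
  note [simp] = integrable_Lp_ball[OF \<phi>]
  have [measurable]: "\<Psi> \<in> borel_measurable borel" and per: "\<And>t. \<Psi> (t + 2*pi) = \<Psi> t"
    using \<Psi> by (auto simp: kernel_def)
  have dev: "integrable period (\<lambda>t. (\<Psi> (x - t) - block \<gamma> 1 m (x - t)) * \<phi> t)"
      "\<bar>LINT t|period. (\<Psi> (x - t) - block \<gamma> 1 m (x - t)) * \<phi> t\<bar> \<le> deviation_const * a m * real m powr (1/p)"
    if "1 \<le> m" for m
  proof -
    have A_pos: "0 < deviation_const * a m * real m powr (1/p)"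
      using deviation_const_pos pos[OF that] that by simp
    have "(\<integral>\<^sup>+t. ennreal (\<bar>\<Psi> (x - t) - block \<gamma> 1 m (x - t)\<bar> powr q) \<partial>period)
        = (\<integral>\<^sup>+t. ennreal (\<bar>\<Psi> t - block \<gamma> 1 m t\<bar> powr q) \<partial>period)"
      by (rule nn_integral_period_reflect[where g = "\<lambda>t. \<Psi> t - block \<gamma> 1 m t" and h = "\<lambda>y. ennreal (\<bar>y\<bar> powr q)"])
         (auto simp: per block_periodic)
    also have "\<dots> \<le> ennreal ((deviation_const * a m * real m powr (1/p)) powr q)"
      by (rule nn_integral_kernel_diff_block_le[OF \<Psi> that])
    finally have R: "(\<integral>\<^sup>+t. ennreal (\<bar>\<Psi> (x - t) - block \<gamma> 1 m (x - t)\<bar> powr q) \<partial>period) \<le> \<dots>" .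
    show "integrable period (\<lambda>t. (\<Psi> (x - t) - block \<gamma> 1 m (x - t)) * \<phi> t)"
      by (rule holder_inequality(1)[OF p q(1,2) A_pos _ _ R Lp_ballD(3)[OF \<phi>]]) auto
    show "\<bar>LINT t|period. (\<Psi> (x - t) - block \<gamma> 1 m (x - t)) * \<phi> t\<bar> \<le> deviation_const * a m * real m powr (1/p)"
      by (rule holder_inequality(2)[OF p q(1,2) A_pos _ _ R Lp_ballD(3)[OF \<phi>]]) auto
  qed
  \<comment> \<open>For m = 1 the block is empty, which leaves the integrand of the convolution
    itself.\<close>
  have int_\<Psi>: "integrable period (\<lambda>t. \<Psi> (x - t) * \<phi> t)"
    using dev(1)[of 1] by (simp add: block_def)
  have block_\<phi>: "block \<gamma> 1 n (x - t) * \<phi> t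
      = (\<Sum>k=1..<n. a k * cos (real k * x) * (\<phi> t * cos (real k * t + \<gamma>))
          + a k * sin (real k * x) * (\<phi> t * sin (real k * t + \<gamma>)))" for t
  proof -
    have "cos (real k * (x - t) - \<gamma>) = cos (real k * x) * cos (real k * t + \<gamma>) + sin (real k * x) * sin (real k * t + \<gamma>)" for k
    proof -
      have "real k * (x - t) - \<gamma> = real k * x - (real k * t + \<gamma>)"
        by (simp add: algebra_simps)
      then show ?thesis
        by (simp only: cos_diff)
    qed
    then show ?thesis
      unfolding block_def sum_distrib_right by (intro sum.cong refl) (simp add: algebra_simps)
  qed
  have "(LINT t|period. block \<gamma> 1 n (x - t) * \<phi> t)
      = (\<Sum>k=1..<n. a k * cos (real k * x) * (LINT t|period. \<phi> t * cos (real k * t + \<gamma>))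
          + a k * sin (real k * x) * (LINT t|period. \<phi> t * sin (real k * t + \<gamma>)))"
    unfolding block_\<phi>
    by (simp only: Bochner_Integration.integral_add Bochner_Integration.integral_sum
        integral_mult_right_zero integrable_period_mult_cos integrable_period_mult_sin integrable_mult_right
        Bochner_Integration.integrable_add Bochner_Integration.integrable_sum integrable_Lp_ball[OF \<phi>])
  also have "\<dots> = pi * (\<Sum>k=1..<n. A k * cos (real k * x) + B k * sin (real k * x))"
    unfolding sum_distrib_left by (intro sum.cong refl) (simp add: A_def B_def field_simps)
  finally have conv_block: "(LINT t|period. block \<gamma> 1 n (x - t) * \<phi> t)
      = pi * (\<Sum>k=1..<n. A k * cos (real k * x) + B k * sin (real k * x))" .
  have "integrable period (\<lambda>t. block \<gamma> 1 n (x - t) * \<phi> t)"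
    using Bochner_Integration.integrable_diff[OF int_\<Psi> dev(1)[OF n]] by (simp add: left_diff_distrib)
  then have "(LINT t|period. (\<Psi> (x - t) - block \<gamma> 1 n (x - t)) * \<phi> t)
      = (LINT t|period. \<Psi> (x - t) * \<phi> t) - (LINT t|period. block \<gamma> 1 n (x - t) * \<phi> t)"
    using int_\<Psi> by (simp add: left_diff_distrib)
  also have "\<dots> = pi * (conv_pi \<Psi> \<phi> x - (\<Sum>k=1..<n. A k * cos (real k * x) + B k * sin (real k * x)))"
    unfolding conv_block by (simp add: conv_pi_def int_pi_eq right_diff_distrib)
  finally have "pi * \<bar>conv_pi \<Psi> \<phi> x - (\<Sum>k=1..<n. A k * cos (real k * x) + B k * sin (real k * x))\<bar>
      \<le> deviation_const * a n * real n powr (1/p)"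
    using dev(2)[OF n] by (simp add: abs_mult)
  then show "\<bar>conv_pi \<Psi> \<phi> x - (\<Sum>k=1..<n. A k * cos (real k * x) + B k * sin (real k * x))\<bar>
      \<le> deviation_const / pi * a n * real n powr (1/p)"
    by (simp add: field_simps)
qed

text \<open>The decay condition bounds the product by a multiple of n^(1/p-\<alpha>), whose exponent
  is negative.\<close>

lemma coeff_powr_tendsto_0: "(\<lambda>n. a n * real n powr (1/p)) \<longlonglongrightarrow> 0"
proof (rule tendsto_sandwich[where f = "\<lambda>_. 0"])
  show "(\<lambda>n. K * a 1 * real 1 powr \<alpha> * real n powr (1/p - \<alpha>)) \<longlonglongrightarrow> 0"
    using \<alpha> by (intro tendsto_mult_right_zero tendsto_neg_powr filterlim_real_sequentially) simp
  show "eventually (\<lambda>n. a n * real n powr (1/p) \<le> K * a 1 * real 1 powr \<alpha> * real n powr (1/p - \<alpha>)) sequentially"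
    using eventually_ge_at_top[of 1]
  proof eventually_elim
    case (elim n)
    have "a n * real n powr (1/p) \<le> K * a 1 * real 1 powr \<alpha> * real n powr (-\<alpha>) * real n powr (1/p)"
      using elim by (intro mult_right_mono coeff_le) auto
    also have "\<dots> = K * a 1 * real 1 powr \<alpha> * real n powr (1/p - \<alpha>)"
      by (simp add: mult.assoc powr_add[symmetric])
    finally show ?case .
  qed
  show "eventually (\<lambda>n. 0 \<le> a n * real n powr (1/p)) sequentially"
    using eventually_ge_at_top[of 1] by eventually_elim (simp add: pos less_imp_le)
qed auto

text \<open>The convolution is a uniform limit of the trigonometric polynomials \<open>P n\<close>, so the Fourier
  coefficients of \<open>f\<close> can be read off without Fubini.\<close>
lemma fourier_deviation_le:
  assumes \<Psi>: "kernel \<gamma> \<Psi>" and f: "f \<in> C_class p \<Psi>" and n: "1 \<le> n"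
  shows "\<bar>f x - fourier_partial_sum (n - 1) f x\<bar> \<le> deviation_const / pi * a n * real n powr (1/p)"
proof -
  define D where "D n = deviation_const / pi * a n * real n powr (1/p)" for n
  obtain a0 \<phi> where cont: "continuous_on UNIV f" and \<phi>: "\<phi> \<in> Lp_ball p"
    and fconv: "AE x in lborel. f x = a0/2 + conv_pi \<Psi> \<phi> x"
    using f by (auto simp: C_class_def)
  obtain A B where AB: "\<And>n x. 1 \<le> n \<Longrightarrow>
    \<bar>conv_pi \<Psi> \<phi> x - (\<Sum>k=1..<n. A k * cos (real k * x) + B k * sin (real k * x))\<bar> \<le> D n"
    by (rule conv_kernel_approx[OF \<Psi> \<phi>, folded D_def]) (rule that)
  define P where "P n x = a0/2 + (\<Sum>k=1..<n. A k * cos (real k * x) + B k * sin (real k * x))" for n x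
  have cont_P: "continuous_on UNIV (P n)" for n
    unfolding P_def by (intro continuous_intros)
  have approx: "\<bar>f x - P n x\<bar> \<le> D n" if "1 \<le> n" for n x
  proof (rule AE_bound_continuous[where g = "\<lambda>x. f x - P n x"])
    show "continuous_on UNIV (\<lambda>x. f x - P n x)"
      using cont cont_P by (intro continuous_intros)
    show "AE x in lborel. \<bar>f x - P n x\<bar> \<le> D n"
      using fconv
    proof eventually_elim
      case (elim x)
      then show ?case using AB[OF that, of x] by (simp add: P_def)
    qed
  qed
  have [measurable]: "f \<in> borel_measurable borel" "P n \<in> borel_measurable borel" for n
    using cont cont_P by (auto intro: borel_measurable_continuous_onI)
  have int_diff: "integrable period (\<lambda>t. (f t - P n t) * cos (real k * t + b))" if "1 \<le> n" for n k b
  proof (rule integrable_period_mult_cos)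
    show "integrable period (\<lambda>t. f t - P n t)"
      using approx[OF that] by (intro period.integrable_const_bound[where B = "D n"]) auto
  qed
  have int_P: "integrable period (\<lambda>t. P n t * cos (real k * t + b))" for n k b
  proof (rule integrable_period_mult_cos)
    have "integrable period (\<lambda>t. cos (real k * t))" "integrable period (\<lambda>t. sin (real k * t))" for k
      using integrable_period_cos[of "real k" 0] integrable_period_cos[of "real k" "- pi/2"] by (simp_all add: cos_diff)
    then show "integrable period (P n)"
      unfolding P_def by simp
  qed
  have coeff: "(LINT t|period. f t * cos (real k * t + b)) = (if k = 0 then pi * a0 * cos b else pi * (A k * cos b - B k * sin b))"
    (is "?l = ?r") for k b
  proof -
    \<comment> \<open>From \<open>Suc k\<close> on, \<open>P n\<close> contains frequency
      \<open>k\<close> with its final coefficient, so only the uniform error \<open>D n\<close>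
      remains, and it tends to 0.\<close>
    have bound: "\<bar>?l - ?r\<bar> \<le> 2 * pi * D n" if "n \<ge> Suc k" for n
    proof -
      have "1 \<le> n" "k < n" using that by auto
      have "integrable period (\<lambda>t. (f t - P n t) * cos (real k * t + b) + P n t * cos (real k * t + b))"
        using int_diff[OF \<open>1 \<le> n\<close>] int_P by (rule Bochner_Integration.integrable_add)
      then have int_f: "integrable period (\<lambda>t. f t * cos (real k * t + b))"
        by (simp add: left_diff_distrib)
      have "(LINT t|period. P n t * cos (real k * t + b)) = ?r"
        unfolding P_def integral_trig_poly_mult_cos[OF \<open>k < n\<close>] by simp
      then have "?l - ?r = (LINT t|period. (f t - P n t) * cos (real k * t + b))"
        using int_f int_P by (simp add: left_diff_distrib)
      also have "\<bar>\<dots>\<bar> \<le> (LINT t|period. \<bar>(f t - P n t) * cos (real k * t + b)\<bar>)"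
        using integral_norm_bound[of period "\<lambda>t. (f t - P n t) * cos (real k * t + b)"] by simp
      also have "\<dots> \<le> (LINT t|period. D n)"
      proof (rule integral_mono)
        show "integrable period (\<lambda>t. \<bar>(f t - P n t) * cos (real k * t + b)\<bar>)"
          using int_diff[OF \<open>1 \<le> n\<close>] by (rule integrable_abs)
        show "\<bar>(f t - P n t) * cos (real k * t + b)\<bar> \<le> D n" for t
          using mult_mono[OF approx[OF \<open>1 \<le> n\<close>, of t] abs_cos_le_one[of "real k * t + b"]]
            order_trans[OF abs_ge_zero approx[OF \<open>1 \<le> n\<close>, of t]]
          by (simp add: abs_mult)
      qed simp
      also have "\<dots> = 2 * pi * D n"
        using integral_period_cos[of 0 0] by simp
      finally show ?thesis .
    qed
    have lim: "(\<lambda>n. 2 * pi * D n) \<longlonglongrightarrow> 2 * pi * (deviation_const / pi * 0)"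
      unfolding D_def mult.assoc[of "deviation_const / pi"] by (intro tendsto_intros coeff_powr_tendsto_0)
    have "\<bar>?l - ?r\<bar> \<le> 2 * pi * (deviation_const / pi * 0)"
      by (rule LIMSEQ_le_const[OF lim]) (use bound in blast)
    then show ?thesis by simp
  qed
  have "fourier_cos f 0 = a0"
    using coeff[of 0 0] by (simp add: fourier_cos_def int_pi_eq)
  moreover have "fourier_cos f k = A k" "fourier_sin f k = B k" if "1 \<le> k" for k
    using coeff[of k 0] coeff[of k "- pi/2"] that
    by (simp_all add: fourier_cos_def fourier_sin_def int_pi_eq cos_diff)
  moreover have "{1..n - 1} = {1..<n}"
    using n by auto
  ultimately have "fourier_partial_sum (n - 1) f x = P n x"
    by (simp add: fourier_partial_sum_def P_def)
  then show ?thesis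
    using approx[OF n, of x] by (simp add: D_def)
qed

lemma fourier_dev_le:
  assumes "kernel \<gamma> \<Psi>" "1 \<le> n"
  shows "fourier_dev n (C_class p \<Psi>) \<le> ereal (deviation_const / pi * a n * real n powr (1/p))"
  unfolding fourier_dev_def supnorm_def
  using fourier_deviation_le[OF assms(1) _ assms(2)] by (intro SUP_least) (auto intro!: cSUP_least)

end

section \<open>The lower bound\<close>

definition grid :: "nat \<Rightarrow> (nat \<times> nat) set" where
  "grid n = {..<n} \<times> {..<n}"

lemma finite_grid [simp]: "finite (grid n)"
  by (simp add: grid_def)

text \<open>The squared modulus of the sum of e^(ijt) over j < n, divided by \<open>n\<close> and
  expanded over pairs of indices; the integral over a period is \<open>2*pi\<close>.\<close>

definition fejer :: "nat \<Rightarrow> real \<Rightarrow> real" where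
  "fejer n t = (\<Sum>(i, j)\<in>grid n. cos ((real i - real j) * t)) / real n"

text \<open>Natural subtraction is exact on the grid. The values run from \<open>n\<close> to 3n - 2
  for positive \<open>n\<close>; the cruder upper bound 4n is what two doublings in
  \<open>class_B\<close> reach.\<close>

definition frequency :: "nat \<Rightarrow> nat \<times> nat \<Rightarrow> nat" where
  "frequency n x = 2 * n - 1 + fst x - snd x"

lemma frequency_bounds:
  assumes "x \<in> grid n"
  shows "n \<le> frequency n x" "frequency n x \<le> 4 * n"
  using assms by (auto simp: grid_def frequency_def)

lemma fejer_nonneg: "0 \<le> fejer n t"
proof -
  have "(\<Sum>(i, j)\<in>grid n. cos ((real i - real j) * t))
      = (\<Sum>i<n. cos (real i * t))\<^sup>2 + (\<Sum>i<n. sin (real i * t))\<^sup>2"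
    unfolding grid_def power2_eq_square sum_product sum.cartesian_product[symmetric] sum.distrib[symmetric]
    by (simp add: left_diff_distrib cos_diff)
  then show ?thesis
    by (simp add: fejer_def)
qed

lemma fejer_le: "fejer n t \<le> real n"
proof -
  have "(\<Sum>x\<in>grid n. cos ((real (fst x) - real (snd x)) * t)) \<le> (\<Sum>x\<in>grid n. 1)"
    by (intro sum_mono) simp
  also have "\<dots> = real n * real n"
    by (simp add: grid_def)
  finally show ?thesis
    by (cases "n = 0") (simp_all add: fejer_def field_simps case_prod_unfold)
qed

text \<open>The product formula averages the frequencies N - (i - j) and N + (i - j), and exchanging
  \<open>i\<close> and \<open>j\<close> identifies the two sums. The modulation thus moves the whole
  spectrum to frequencies at least \<open>n\<close>.\<close>

lemma fejer_mult_cos: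
  "fejer n t * cos (real (2 * n - 1) * t - \<delta>) = (\<Sum>x\<in>grid n. cos (real (frequency n x) * t - \<delta>)) / real n"
proof -
  define N where "N = 2 * n - 1"
  define c where "c x = cos ((real N + real (fst x) - real (snd x)) * t - \<delta>)" for x :: "nat \<times> nat"
  have swap: "(\<Sum>x\<in>grid n. c (snd x, fst x)) = (\<Sum>x\<in>grid n. c x)"
    by (rule sum.reindex_bij_witness[of _ prod.swap prod.swap]) (auto simp: grid_def)
  have "(\<Sum>x\<in>grid n. cos ((real (fst x) - real (snd x)) * t)) * cos (real N * t - \<delta>)
      = (\<Sum>x\<in>grid n. (c (snd x, fst x) + c x) / 2)"
    unfolding sum_distrib_right
  proof (intro sum.cong refl)
    fix x :: "nat \<times> nat"
    have "cos (real N * t - \<delta>) * cos ((real (fst x) - real (snd x)) * t)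
      = (cos (real N * t - \<delta> - (real (fst x) - real (snd x)) * t)
        + cos (real N * t - \<delta> + (real (fst x) - real (snd x)) * t)) / 2"
      by (rule cos_times_cos)
    then show "cos ((real (fst x) - real (snd x)) * t) * cos (real N * t - \<delta>) = (c (snd x, fst x) + c x) / 2"
      by (simp add: c_def algebra_simps)
  qed
  also have "\<dots> = (\<Sum>x\<in>grid n. c x)"
    unfolding sum_divide_distrib[symmetric] sum.distrib swap by simp
  also have "\<dots> = (\<Sum>x\<in>grid n. cos (real (frequency n x) * t - \<delta>))"
  proof (intro sum.cong refl)
    fix x assume "x \<in> grid n"
    then have "snd x \<le> N + fst x"
      by (auto simp: grid_def N_def)
    then have "real (frequency n x) = real N + real (fst x) - real (snd x)"
      unfolding frequency_def N_def[symmetric] by (simp add: of_nat_diff)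
    then show "c x = cos (real (frequency n x) * t - \<delta>)"
      by (simp only: c_def)
  qed
  finally show ?thesis
    by (simp add: fejer_def N_def case_prod_unfold)
qed

lemma fejer_measurable [measurable]: "fejer n \<in> borel_measurable borel"
  unfolding fejer_def case_prod_unfold by measurable

lemma integrable_fejer: "integrable period (fejer n)"
  by (rule period.integrable_const_bound[where B = "real n"])
     (use fejer_nonneg fejer_le in \<open>auto simp: abs_of_nonneg\<close>)

lemma integral_fejer:
  assumes "1 \<le> n"
  shows "(LINT t|period. fejer n t) = 2 * pi"
proof -
  have int: "integrable period (\<lambda>t. cos ((real (fst x) - real (snd x)) * t))" for x :: "nat \<times> nat"
    using integrable_period_cos[of "real (fst x) - real (snd x)" 0] by simp
  have val: "(LINT t|period. cos ((real (fst x) - real (snd x)) * t)) = (if fst x = snd x then 2 * pi else 0)"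
    for x :: "nat \<times> nat"
    using integral_period_cos[of "int (fst x) - int (snd x)" 0]
    by (simp only: of_int_diff of_int_of_nat_eq right_minus_eq of_nat_eq_iff add_0_right cos_zero mult_1_right)
  have "(LINT t|period. fejer n t)
      = (\<Sum>x\<in>grid n. LINT t|period. cos ((real (fst x) - real (snd x)) * t)) / real n"
    unfolding fejer_def case_prod_unfold
    by (subst integral_divide_zero, subst Bochner_Integration.integral_sum) (use int in auto)
  also have "\<dots> = (\<Sum>x\<in>grid n. if fst x = snd x then 2 * pi else 0) / real n"
    by (simp only: val)
  also have "(\<Sum>x\<in>grid n. if fst x = snd x then 2 * pi else 0) = (\<Sum>i<n. \<Sum>j<n. if i = j then 2 * pi else 0)"
    unfolding grid_def sum.cartesian_product by (simp add: case_prod_unfold)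
  also have "\<dots> = real n * (2 * pi)"
    by simp
  finally show ?thesis using assms by simp
qed

text \<open>Two index pairs collide when they have the same difference. A triple (a, c, d) yields
  the pairs (a + d, a) and (c + d, c), both of difference \<open>d\<close>; entries below
  \<open>h\<close>, half of \<open>n\<close> rounded up, keep the sums below
  \<open>n\<close>.\<close>

lemma card_frequency_collisions:
  "real n ^ 3 / 8 \<le> real (card {z \<in> grid n \<times> grid n. frequency n (fst z) = frequency n (snd z)})"
proof -
  define h where "h = (n + 1) div 2"
  let ?f = "\<lambda>(a, c, d). ((a + d, a), (c + d, c)) :: (nat \<times> nat) \<times> (nat \<times> nat)"
  let ?Q = "{z \<in> grid n \<times> grid n. frequency n (fst z) = frequency n (snd z)}"
  have h: "i < n" "i + j < n" if "i < h" "j < h" for i j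
    using that unfolding h_def by linarith+
  have "card ({..<h} \<times> {..<h} \<times> {..<h}) \<le> card ?Q"
  proof (rule card_inj_on_le[where f = ?f])
    show "inj_on ?f ({..<h} \<times> {..<h} \<times> {..<h})"
      by (auto simp: inj_on_def)
    show "?f ` ({..<h} \<times> {..<h} \<times> {..<h}) \<subseteq> ?Q"
      using h by (auto simp: grid_def frequency_def)
  qed simp
  then have card: "real h ^ 3 \<le> real (card ?Q)"
    unfolding of_nat_power[symmetric] of_nat_le_iff
    by (simp add: card_cartesian_product power3_eq_cube mult.assoc)
  have "real n / 2 \<le> real h"
    unfolding h_def by linarith
  then have "(real n / 2) ^ 3 \<le> real h ^ 3"
    by (intro power_mono) auto
  also note card
  finally show ?thesis
    by (simp add: power_divide)
qed

lemma integral_trig_poly_mult_fejer: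
  assumes "\<tau> \<in> trig_polys n" "1 \<le> n"
  shows "(LINT t|period. \<tau> t * (fejer n t * cos (real (2 * n - 1) * t - \<delta>))) = 0"
proof -
  obtain c A B where \<tau>: "\<tau> = (\<lambda>x. c + (\<Sum>k=1..<n. A k * cos (real k * x) + B k * sin (real k * x)))"
    using assms by (auto simp: trig_polys_def)
  have 0: "(LINT t|period. \<tau> t * cos (real m * t - \<delta>)) = 0" if "n \<le> m" for m
  proof -
    \<comment> \<open>Padding with zero coefficients up to \<open>m\<close> brings frequency
      \<open>m\<close> into the range of \<open>integral_trig_poly_mult_cos\<close>.\<close>
    have "\<tau> t = c + (\<Sum>j=1..<Suc m. (if j < n then A j else 0) * cos (real j * t) + (if j < n then B j else 0) * sin (real j * t))" for t
    proof -
      have "(\<Sum>j=1..<Suc m. (if j < n then A j else 0) * cos (real j * t) + (if j < n then B j else 0) * sin (real j * t))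
          = (\<Sum>j=1..<n. A j * cos (real j * t) + B j * sin (real j * t))"
        using that by (intro sum.mono_neutral_cong_right) auto
      then show ?thesis by (simp only: \<tau>)
    qed
    then have "(LINT t|period. \<tau> t * cos (real m * t - \<delta>))
      = (LINT t|period. (c + (\<Sum>j=1..<Suc m. (if j < n then A j else 0) * cos (real j * t) + (if j < n then B j else 0) * sin (real j * t)))
          * cos (real m * t + (- \<delta>)))"
      by (simp only: add_uminus_conv_diff)
    also have "\<dots> = 0"
      using that assms by (subst integral_trig_poly_mult_cos) auto
    finally show ?thesis .
  qed
  have "integrable period \<tau>"
  proof -
    have "integrable period (\<lambda>t. cos (real k * t))" "integrable period (\<lambda>t. sin (real k * t))" for k
      using integrable_period_cos[of "real k" 0] integrable_period_cos[of "real k" "- pi/2"] by (simp_all add: cos_diff)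
    then show ?thesis
      unfolding \<tau> by simp
  qed
  then have int: "integrable period (\<lambda>t. \<tau> t * cos (real m * t - \<delta>))" for m
    using integrable_period_mult_cos[of \<tau> "real m" "- \<delta>"] by simp
  have "(LINT t|period. \<tau> t * (fejer n t * cos (real (2 * n - 1) * t - \<delta>)))
      = (LINT t|period. (\<Sum>x\<in>grid n. \<tau> t * cos (real (frequency n x) * t - \<delta>)) / real n)"
    unfolding fejer_mult_cos by (simp add: sum_distrib_left)
  also have "\<dots> = (\<Sum>x\<in>grid n. LINT t|period. \<tau> t * cos (real (frequency n x) * t - \<delta>)) / real n"
    by (subst integral_divide_zero, subst Bochner_Integration.integral_sum) (use int in auto)
  also have "\<dots> = 0"
    using 0 frequency_bounds by simp
  finally show ?thesis .
qed

section \<open>The extremal function and the duality estimate\<close>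

context decaying_coeffs
begin

text \<open>The normalisation forced by the estimate that the integral of
  \<open>fejer n t powr p\<close> is at most 2 pi n^(p-1).\<close>

definition extremal_const :: "nat \<Rightarrow> real" where
  "extremal_const n = (2*pi) powr (-1/p) * real n powr (1/p - 1)"

definition extremal_density :: "nat \<Rightarrow> real \<Rightarrow> real" where
  "extremal_density n t = extremal_const n * (fejer n t * cos (real (2 * n - 1) * t))"

text \<open>The convolution of the kernel with \<open>extremal_density n\<close> in closed form, so
  that continuity and periodicity are immediate.\<close>

definition extremal :: "real \<Rightarrow> nat \<Rightarrow> real \<Rightarrow> real" where
  "extremal \<gamma> n x = extremal_const n / real n * (\<Sum>z\<in>grid n. a (frequency n z) * cos (real (frequency n z) * x - \<gamma>))"

lemma extremal_const_nonneg: "0 \<le> extremal_const n"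
  by (simp add: extremal_const_def)

lemma extremal_density_eq:
  "extremal_density n t = extremal_const n / real n * (\<Sum>z\<in>grid n. cos (real (frequency n z) * t))"
  using fejer_mult_cos[of n t 0] by (simp add: extremal_density_def)

text \<open>From 0 <= F <= n follows F^p <= n^(p-1) F, and the integral of F is known
  exactly.\<close>

lemma extremal_density_in_Lp_ball:
  assumes n: "1 \<le> n"
  shows "extremal_density n \<in> Lp_ball p"
proof -
  have per: "extremal_density n (t + 2*pi) = extremal_density n t" for t
    using cos_frequency_periodic[of _ t 0] by (simp add: extremal_density_eq)
  have [measurable]: "extremal_density n \<in> borel_measurable borel"
    unfolding extremal_density_eq by measurable
  have "\<bar>extremal_density n t\<bar> powr p \<le> fejer n t / (2*pi)" for t
  proof -
    have "\<bar>fejer n t * cos (real (2 * n - 1) * t)\<bar> \<le> fejer n t"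
      using fejer_nonneg[of n t] by (simp add: abs_mult mult_left_le del: of_nat_diff)
    then have "\<bar>extremal_density n t\<bar> \<le> extremal_const n * fejer n t"
      unfolding extremal_density_def using extremal_const_nonneg[of n]
      by (simp only: abs_mult[of "extremal_const n"] abs_of_nonneg mult_left_mono)
    then have "\<bar>extremal_density n t\<bar> powr p \<le> (extremal_const n * fejer n t) powr p"
      using p by (intro powr_mono2) auto
    also have "\<dots> = extremal_const n powr p * fejer n t powr p"
      by (rule powr_mult)
    also have "\<dots> \<le> extremal_const n powr p * (real n powr (p - 1) * fejer n t)"
    proof (intro mult_left_mono)
      have "fejer n t powr p = fejer n t powr (p - 1) * fejer n t"
        using fejer_nonneg[of n t] by (cases "fejer n t = 0") (auto simp: powr_diff)
      also have "\<dots> \<le> real n powr (p - 1) * fejer n t"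
        using p fejer_nonneg[of n t] fejer_le[of n t] by (intro mult_right_mono powr_mono2) auto
      finally show "fejer n t powr p \<le> real n powr (p - 1) * fejer n t" .
    qed simp
    also have "extremal_const n powr p = (2*pi) powr (-1) * real n powr (1 - p)"
      using p by (simp add: extremal_const_def powr_mult powr_powr left_diff_distrib)
    also have "(2*pi) powr (-1) * real n powr (1 - p) * (real n powr (p - 1) * fejer n t)
        = (2*pi) powr (-1) * (real n powr (1 - p) * real n powr (p - 1)) * fejer n t"
      by (simp only: mult.assoc)
    also have "\<dots> = fejer n t / (2*pi)"
      using n unfolding powr_add[symmetric] by (simp add: powr_minus_divide)
    finally show ?thesis .
  qed
  then have "(\<integral>\<^sup>+t. ennreal (\<bar>extremal_density n t\<bar> powr p) \<partial>period) \<le> (\<integral>\<^sup>+t. ennreal (fejer n t / (2*pi)) \<partial>period)"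
    by (intro nn_integral_mono ennreal_leI)
  also have "\<dots> = ennreal (LINT t|period. fejer n t / (2*pi))"
    using integrable_fejer[of n] fejer_nonneg by (intro nn_integral_eq_integral) auto
  also have "\<dots> = 1"
    using integral_fejer[OF n] by simp
  finally have "(\<integral>\<^sup>+t. ennreal (\<bar>extremal_density n t\<bar> powr p) \<partial>period) \<le> 1" .
  moreover have "(\<integral>\<^sup>+t. ennreal (\<bar>extremal_density n t\<bar> powr p) * indicator {0..0 + 2*pi} t \<partial>lborel)
      = (\<integral>\<^sup>+t. ennreal (\<bar>extremal_density n t\<bar> powr p) \<partial>period)"
    by (rule nn_integral_periodic_interval) (auto simp: per)
  ultimately show ?thesis
    using per by (simp add: Lp_ball_def periodic2pi_def)
qed

text \<open>Reflection turns the integrand into \<Psi>(s) cos(ms - mx), a Fourier coefficient of the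
  kernel with phase -mx.\<close>

lemma integral_kernel_reflect_mult_cos:
  assumes "kernel \<gamma> \<Psi>" "1 \<le> m"
  shows "integrable period (\<lambda>t. \<Psi> (x - t) * cos (real m * t))"
    and "(LINT t|period. \<Psi> (x - t) * cos (real m * t)) = pi * a m * cos (real m * x - \<gamma>)"
proof -
  define g where "g s = \<Psi> s * cos (real m * s + (- real m * x))" for s
  have \<Psi>: "\<And>t. \<Psi> (t + 2*pi) = \<Psi> t" "integrable period \<Psi>"
    and [measurable]: "\<Psi> \<in> borel_measurable borel"
    and coeff: "\<And>m b. (LINT t|period. \<Psi> t * cos (real m * t + b)) = (if m = 0 then 0 else pi * a m * cos (\<gamma> + b))"
    using assms by (auto simp: kernel_def)
  have [measurable]: "g \<in> borel_measurable borel"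
    unfolding g_def by measurable
  have per: "g (t + 2*pi) = g t" for t
    using \<Psi>(1) cos_frequency_periodic[of m t "- real m * x"] by (simp only: g_def)
  have g_reflect: "g (x - t) = \<Psi> (x - t) * cos (real m * t)" for t
  proof -
    have "real m * (x - t) + (- real m * x) = - (real m * t)"
      by (simp add: algebra_simps)
    then show ?thesis
      by (simp only: g_def cos_minus)
  qed
  have "integrable period g"
    unfolding g_def by (rule integrable_period_mult_cos[OF \<Psi>(2)])
  then show "integrable period (\<lambda>t. \<Psi> (x - t) * cos (real m * t))"
    using integrable_period_reflect[of g x] per by (simp add: g_reflect)
  have "(LINT t|period. \<Psi> (x - t) * cos (real m * t)) = (LINT t|period. g t)"
    using integral_period_reflect[of g x] per by (simp add: g_reflect)
  also have "\<dots> = pi * a m * cos (\<gamma> + (- real m * x))"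
    unfolding g_def coeff using assms by simp
  also have "cos (\<gamma> + (- real m * x)) = cos (real m * x - \<gamma>)"
    using cos_minus[of "real m * x - \<gamma>"] by simp
  finally show "(LINT t|period. \<Psi> (x - t) * cos (real m * t)) = pi * a m * cos (real m * x - \<gamma>)" .
qed

lemma conv_extremal_density:
  assumes "kernel \<gamma> \<Psi>" "1 \<le> n"
  shows "conv_pi \<Psi> (extremal_density n) x = extremal \<gamma> n x"
proof -
  have freq: "1 \<le> frequency n z" if "z \<in> grid n" for z
    using frequency_bounds[OF that] assms by simp
  have "conv_pi \<Psi> (extremal_density n) x
      = 1/pi * (LINT t|period. extremal_const n / real n * (\<Sum>z\<in>grid n. \<Psi> (x - t) * cos (real (frequency n z) * t)))"
    unfolding conv_pi_def int_pi_eq extremal_density_eq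
    by (simp only: sum_distrib_left mult_ac)
  also have "\<dots> = 1/pi * (extremal_const n / real n * (\<Sum>z\<in>grid n. LINT t|period. \<Psi> (x - t) * cos (real (frequency n z) * t)))"
    using integral_kernel_reflect_mult_cos(1)[OF assms(1) freq]
    by (subst integral_mult_right_zero, subst Bochner_Integration.integral_sum) auto
  also have "(\<Sum>z\<in>grid n. LINT t|period. \<Psi> (x - t) * cos (real (frequency n z) * t))
      = (\<Sum>z\<in>grid n. pi * (a (frequency n z) * cos (real (frequency n z) * x - \<gamma>)))"
    by (intro sum.cong refl) (simp only: integral_kernel_reflect_mult_cos(2)[OF assms(1) freq] mult.assoc)
  finally show ?thesis
    unfolding sum_distrib_left[symmetric] by (simp add: extremal_def)
qed

lemma extremal_continuous: "continuous_on UNIV (extremal \<gamma> n)"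
  unfolding extremal_def by (intro continuous_intros)

lemma extremal_periodic: "periodic2pi (extremal \<gamma> n)"
  using cos_frequency_periodic[of _ _ "- \<gamma>"] by (simp add: periodic2pi_def extremal_def)

lemma extremal_in_C_class:
  assumes "kernel \<gamma> \<Psi>" "1 \<le> n"
  shows "extremal \<gamma> n \<in> C_class p \<Psi>"
proof -
  have "(LINT t|period. cos (real (frequency n z) * t)) = 0" if "z \<in> grid n" for z
    using integral_period_cos[of "int (frequency n z)" 0] frequency_bounds[OF that] assms(2) by simp
  moreover have "integrable period (\<lambda>t. cos (real k * t))" for k
    using integrable_period_cos[of "real k" 0] by simp
  ultimately have "int_pi (extremal_density n) = 0"
    by (simp add: int_pi_eq extremal_density_eq[abs_def])
  then have "\<exists>a0 \<phi>. \<phi> \<in> Lp_ball p \<and> int_pi \<phi> = 0 \<and>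
      (AE x in lborel. extremal \<gamma> n x = a0/2 + conv_pi \<Psi> \<phi> x)"
    using extremal_density_in_Lp_ball[OF assms(2)] conv_extremal_density[OF assms]
    by (intro exI[of _ 0] exI[of _ "extremal_density n"]) simp
  then show ?thesis
    using extremal_continuous extremal_periodic by (simp add: C_class_def)
qed

text \<open>The test function carries the same phase \<gamma> as \<open>extremal\<close>, so each
  pair of equal frequencies contributes \<open>pi\<close> times a positive coefficient, whatever
  \<gamma> is, and all other pairs contribute 0. The coefficients are at least
  \<open>a (4 * n)\<close>, and the number of pairs is of order n^3.\<close>

lemma integral_extremal_mult_fejer_ge:
  assumes n: "1 \<le> n"
  shows "extremal_const n * a (4 * n) * real n * pi / 8
    \<le> (LINT t|period. extremal \<gamma> n t * (fejer n t * cos (real (2 * n - 1) * t - \<gamma>)))"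
proof -
  let ?Z = "grid n" and ?\<nu> = "frequency n"
  have "integrable period (\<lambda>t. cos (real k * t - \<gamma>) * cos (real m * t + (- \<gamma>)))" for k m
    using integrable_period_mult_cos[OF integrable_period_cos[of "real k" "- \<gamma>"], of "real m" "- \<gamma>"] by simp
  then have int: "integrable period (\<lambda>t. cos (real k * t - \<gamma>) * cos (real m * t - \<gamma>))" for k m
    by simp
  have orth: "(LINT t|period. cos (real (?\<nu> y) * t - \<gamma>) * cos (real (?\<nu> z) * t - \<gamma>)) = (if ?\<nu> y = ?\<nu> z then pi else 0)"
    if "y \<in> ?Z" for y z
    using integral_period_cos_mult_cos[of "?\<nu> y" \<gamma> "?\<nu> z" "- \<gamma>"] frequency_bounds[OF that] n by simp
  define Q where "Q = {z \<in> ?Z \<times> ?Z. ?\<nu> (fst z) = ?\<nu> (snd z)}"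
  have [simp]: "finite Q" by (simp add: Q_def)
  have "a (4 * n) * pi * (real n ^ 3 / 8) \<le> a (4 * n) * pi * real (card Q)"
    unfolding Q_def using pos[of "4 * n"] n by (intro mult_left_mono card_frequency_collisions) auto
  also have "\<dots> = (\<Sum>z\<in>Q. a (4 * n) * pi)"
    by simp
  also have "\<dots> \<le> (\<Sum>z\<in>Q. a (?\<nu> (fst z)) * pi)"
  proof (intro sum_mono mult_right_mono antimono)
    fix z assume "z \<in> Q"
    then have "fst z \<in> ?Z" by (auto simp: Q_def)
    from frequency_bounds[OF this] show "1 \<le> ?\<nu> (fst z)" "?\<nu> (fst z) \<le> 4 * n"
      using n by auto
  qed simp
  also have "\<dots> = (\<Sum>z\<in>?Z \<times> ?Z. a (?\<nu> (fst z)) * (if ?\<nu> (fst z) = ?\<nu> (snd z) then pi else 0))"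
    unfolding Q_def by (rule sum.mono_neutral_cong_left) auto
  also have "\<dots> = (\<Sum>y\<in>?Z. \<Sum>z\<in>?Z. a (?\<nu> y) * (if ?\<nu> y = ?\<nu> z then pi else 0))"
    unfolding sum.cartesian_product by (simp add: case_prod_unfold)
  also have "\<dots> = (\<Sum>y\<in>?Z. \<Sum>z\<in>?Z. LINT t|period. a (?\<nu> y) * (cos (real (?\<nu> y) * t - \<gamma>) * cos (real (?\<nu> z) * t - \<gamma>)))"
    by (intro sum.cong refl) (simp only: integral_mult_right_zero orth)
  also have "\<dots> = (LINT t|period. (\<Sum>y\<in>?Z. \<Sum>z\<in>?Z. a (?\<nu> y) * (cos (real (?\<nu> y) * t - \<gamma>) * cos (real (?\<nu> z) * t - \<gamma>))))"
    using int by (simp add: Bochner_Integration.integral_sum)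
  finally have main: "a (4 * n) * pi * (real n ^ 3 / 8) \<le> \<dots>" .
  have "extremal \<gamma> n t * (fejer n t * cos (real (2 * n - 1) * t - \<gamma>))
      = extremal_const n / real n ^ 2 * (\<Sum>y\<in>?Z. \<Sum>z\<in>?Z. a (?\<nu> y) * (cos (real (?\<nu> y) * t - \<gamma>) * cos (real (?\<nu> z) * t - \<gamma>)))" for t
  proof -
    have "(\<Sum>y\<in>?Z. a (?\<nu> y) * cos (real (?\<nu> y) * t - \<gamma>)) * (\<Sum>z\<in>?Z. cos (real (?\<nu> z) * t - \<gamma>))
       = (\<Sum>y\<in>?Z. \<Sum>z\<in>?Z. a (?\<nu> y) * (cos (real (?\<nu> y) * t - \<gamma>) * cos (real (?\<nu> z) * t - \<gamma>)))"
      unfolding sum_product by (simp only: mult.assoc)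
    from this[symmetric] show ?thesis
      unfolding extremal_def fejer_mult_cos by (simp add: power2_eq_square)
  qed
  then have "(LINT t|period. extremal \<gamma> n t * (fejer n t * cos (real (2 * n - 1) * t - \<gamma>)))
      = extremal_const n / real n ^ 2 * (LINT t|period. (\<Sum>y\<in>?Z. \<Sum>z\<in>?Z. a (?\<nu> y) * (cos (real (?\<nu> y) * t - \<gamma>) * cos (real (?\<nu> z) * t - \<gamma>))))"
    by (simp only: integral_mult_right_zero)
  also have "\<dots> \<ge> extremal_const n / real n ^ 2 * (a (4 * n) * pi * (real n ^ 3 / 8))"
    using extremal_const_nonneg by (intro mult_left_mono main) auto
  also have "extremal_const n / real n ^ 2 * (a (4 * n) * pi * (real n ^ 3 / 8)) = extremal_const n * a (4 * n) * real n * pi / 8"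
    using n by (simp add: power2_eq_square power3_eq_cube)
  finally show ?thesis .
qed

text \<open>Duality: the test function annihilates every admissible \<tau>, so pairing it with the
  difference gives the same value as pairing it with \<open>extremal\<close>; its L_1 norm is at
  most \<open>2*pi\<close>.\<close>

lemma supnorm_extremal_diff_ge:
  assumes n: "1 \<le> n" and \<tau>: "\<tau> \<in> trig_polys n"
  shows "(2*pi) powr (-1/p) / 16 * a (4 * n) * real n powr (1/p) \<le> supnorm (\<lambda>x. extremal \<gamma> n x - \<tau> x)"
proof -
  let ?f = "extremal \<gamma> n" and ?g = "\<lambda>t. fejer n t * cos (real (2 * n - 1) * t - \<gamma>)"
  define S where "S = supnorm (\<lambda>x. ?f x - \<tau> x)"
  have S: "\<bar>?f x - \<tau> x\<bar> \<le> S" for x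
    unfolding S_def by (rule abs_le_supnorm_diff[OF extremal_continuous extremal_periodic \<tau>])
  have "0 \<le> S"
    using S[of 0] by linarith
  have bounded: "bdd_above (range (\<lambda>x. \<bar>h x\<bar>)) \<Longrightarrow> continuous_on UNIV h \<Longrightarrow> integrable period (\<lambda>t. h t * ?g t)"
    for h :: "real \<Rightarrow> real"
  proof -
    assume "bdd_above (range (\<lambda>x. \<bar>h x\<bar>))" "continuous_on UNIV h"
    then obtain B where B: "\<And>x. \<bar>h x\<bar> \<le> B" and [measurable]: "h \<in> borel_measurable borel"
      by (auto simp: bdd_above_def intro: borel_measurable_continuous_onI)
    have "\<bar>h t * cos (real (2 * n - 1) * t - \<gamma>)\<bar> \<le> B" for t
      using mult_mono[OF B[of t] abs_cos_le_one[of "real (2 * n - 1) * t - \<gamma>"]] order_trans[OF abs_ge_zero B[of t]]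
      by (simp add: abs_mult)
    then have "integrable period (\<lambda>t. fejer n t * (h t * cos (real (2 * n - 1) * t - \<gamma>)))"
      by (intro integrable_period_mult_bounded[OF integrable_fejer]) auto
    then show "integrable period (\<lambda>t. h t * ?g t)"
      by (simp only: mult_ac)
  qed
  have int: "integrable period (\<lambda>t. ?f t * ?g t)" "integrable period (\<lambda>t. \<tau> t * ?g t)"
    using extremal_periodic trig_polys_periodic_continuous[OF \<tau>]
    by (intro bounded periodic_continuous_bounded extremal_continuous; simp add: periodic2pi_def)+
  have "extremal_const n * a (4 * n) * real n * pi / 8 \<le> (LINT t|period. ?f t * ?g t)"
    by (rule integral_extremal_mult_fejer_ge[OF n])
  also have "\<dots> = (LINT t|period. (?f t - \<tau> t) * ?g t)"
    using int integral_trig_poly_mult_fejer[OF \<tau> n] by (simp add: left_diff_distrib)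
  also have "\<dots> \<le> (LINT t|period. S * fejer n t)"
  proof (rule integral_mono)
    show "integrable period (\<lambda>t. (?f t - \<tau> t) * ?g t)"
      using int by (simp add: left_diff_distrib)
    show "integrable period (\<lambda>t. S * fejer n t)"
      using integrable_fejer by simp
    show "(?f t - \<tau> t) * ?g t \<le> S * fejer n t" for t
    proof -
      have "\<bar>?g t\<bar> \<le> fejer n t"
        using fejer_nonneg[of n t] by (simp add: abs_mult mult_left_le del: of_nat_diff)
      then have "\<bar>?f t - \<tau> t\<bar> * \<bar>?g t\<bar> \<le> S * fejer n t"
        using S[of t] \<open>0 \<le> S\<close> by (intro mult_mono) auto
      then show ?thesis
        using abs_ge_self[of "(?f t - \<tau> t) * ?g t"] by (simp only: abs_mult)
    qed
  qed
  also have "\<dots> = S * (2 * pi)"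
    using integral_fejer[OF n] by simp
  \<comment> \<open>The factor 16 arises from dividing pi/8 by \<open>2*pi\<close>.\<close>
  finally have "extremal_const n * real n * a (4 * n) / 16 \<le> S"
    by (simp add: mult_ac)
  moreover have "extremal_const n * real n = (2*pi) powr (-1/p) * real n powr (1/p)"
    using n by (simp add: extremal_const_def powr_diff)
  ultimately have "((2*pi) powr (-1/p) * real n powr (1/p)) * a (4 * n) / 16 \<le> S"
    by (simp only:)
  then show ?thesis
    by (simp add: S_def mult_ac)
qed

lemma best_approx_ge:
  assumes "kernel \<gamma> \<Psi>" "1 \<le> n"
  shows "ereal ((2*pi) powr (-1/p) / 16 * a (4 * n) * real n powr (1/p)) \<le> best_approx n (C_class p \<Psi>)"
proof -
  have "(2*pi) powr (-1/p) / 16 * a (4 * n) * real n powr (1/p)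
      \<le> (INF \<tau>\<in>trig_polys n. supnorm (\<lambda>x. extremal \<gamma> n x - \<tau> x))"
    using supnorm_extremal_diff_ge[OF assms(2)] by (intro cINF_greatest) (auto simp: trig_polys_def)
  then have "ereal ((2*pi) powr (-1/p) / 16 * a (4 * n) * real n powr (1/p))
      \<le> ereal (INF \<tau>\<in>trig_polys n. supnorm (\<lambda>x. extremal \<gamma> n x - \<tau> x))"
    by simp
  also have "\<dots> \<le> best_approx n (C_class p \<Psi>)"
    unfolding best_approx_def by (rule SUP_upper) (rule extremal_in_C_class[OF assms])
  finally show ?thesis .
qed

end

section \<open>The two-sided estimate\<close>

text \<open>An almost decreasing bound for \<alpha> passes to any smaller exponent \<delta>, because
  t^(\<delta>-\<alpha>) is nonincreasing; \<delta> is kept between 1/p and 1.\<close>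

lemma class_Theta_decaying_coeffs:
  assumes "1 < p" and pos: "\<forall>t\<ge>1. 0 < \<psi> t" and \<psi>: "\<psi> \<in> class_Theta p"
  obtains \<alpha> K where "decaying_coeffs (\<lambda>k. \<psi> (real k)) \<alpha> K p"
proof -
  obtain \<alpha> K where \<alpha>: "1/p < \<alpha>" and K: "0 < K"
    and almost: "\<And>t1 t2. t1 > t2 \<Longrightarrow> t2 \<ge> 1 \<Longrightarrow> t1 powr \<alpha> * \<psi> t1 \<le> K * (t2 powr \<alpha> * \<psi> t2)"
    and mono: "\<And>s t. 1 \<le> s \<Longrightarrow> s \<le> t \<Longrightarrow> \<psi> t \<le> \<psi> s"
    using \<psi> by (auto simp: class_Theta_def)
  define \<delta> where "\<delta> = min \<alpha> ((1 + 1/p) / 2)" \<comment> \<open>lowers the exponent below 1\<close>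
  have "1/p < (1 + 1/p) / 2" "(1 + 1/p) / 2 < 1"
    using \<open>1 < p\<close> by (auto simp: field_simps)
  then have \<delta>: "1/p < \<delta>" "\<delta> < 1" "\<delta> \<le> \<alpha>"
    using \<alpha> unfolding \<delta>_def by (simp_all only: min_less_iff_conj min_less_iff_disj min.cobounded1 simp_thms)
  \<comment> \<open>\<open>class_Theta\<close> compares distinct points only; a constant of at least
    1 also covers k = l.\<close>
  have "decaying_coeffs (\<lambda>k. \<psi> (real k)) \<delta> (max 1 K) p"
  proof
    fix k l :: nat assume k: "1 \<le> k" and "k \<le> l"
    show "real l powr \<delta> * \<psi> (real l) \<le> max 1 K * (real k powr \<delta> * \<psi> (real k))"
    proof (cases "k = l")
      case True
      have "0 \<le> real k powr \<delta> * \<psi> (real k)"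
        using pos k by (simp add: less_imp_le)
      from mult_right_mono[OF max.cobounded1[of 1 K] this] show ?thesis
        using True by simp
    next
      case False
      have split: "real m powr \<delta> = real m powr (\<delta> - \<alpha>) * real m powr \<alpha>" for m
        by (simp add: powr_add[symmetric])
      have "real l powr \<delta> * \<psi> (real l) = real l powr (\<delta> - \<alpha>) * (real l powr \<alpha> * \<psi> (real l))"
        by (subst split) simp
      also have "\<dots> \<le> real k powr (\<delta> - \<alpha>) * (K * (real k powr \<alpha> * \<psi> (real k)))"
      proof (rule mult_mono)
        show "real l powr (\<delta> - \<alpha>) \<le> real k powr (\<delta> - \<alpha>)"
          using k \<open>k \<le> l\<close> \<delta> by (intro powr_mono2') auto
        show "real l powr \<alpha> * \<psi> (real l) \<le> K * (real k powr \<alpha> * \<psi> (real k))"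
          using k \<open>k \<le> l\<close> False by (intro almost) auto
        show "0 \<le> real l powr \<alpha> * \<psi> (real l)"
          using pos k \<open>k \<le> l\<close> by (simp add: less_imp_le)
      qed simp
      also have "\<dots> = K * (real k powr \<delta> * \<psi> (real k))"
        by (subst split) simp
      also have "\<dots> \<le> max 1 K * (real k powr \<delta> * \<psi> (real k))"
        using pos k by (intro mult_right_mono) (auto simp: less_imp_le)
      finally show ?thesis .
    qed
  qed (use \<open>1 < p\<close> \<delta> pos mono in auto)
  then show thesis by (rule that)
qed

text \<open>Two doublings compare the coefficient at 4n, which appears in the lower bound, with the
  one at \<open>n\<close>.\<close>

lemma class_B_quadruple:
  assumes "\<psi> \<in> class_B"
  obtains L where "0 < L" "\<And>n::nat. 1 \<le> n \<Longrightarrow> L * \<psi> (real n) \<le> \<psi> (real (4 * n))"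
proof -
  obtain K where K: "K > 0" and doubling: "\<And>t. t \<ge> 1 \<Longrightarrow> \<psi> t / \<psi> (2*t) \<le> K" and pos: "\<And>t. t \<ge> 1 \<Longrightarrow> 0 < \<psi> t"
    using assms by (auto simp: class_B_def)
  have step: "\<psi> t \<le> K * \<psi> (2*t)" if "t \<ge> 1" for t
    using doubling[OF that] pos[of "2*t"] that by (simp add: field_simps)
  show thesis
  proof (rule that[of "1 / (K * K)"])
    fix n :: nat assume "1 \<le> n"
    then have "\<psi> (real n) \<le> K * (K * \<psi> (2 * (2 * real n)))"
      using K by (intro order_trans[OF step] mult_left_mono step) auto
    then show "1 / (K * K) * \<psi> (real n) \<le> \<psi> (real (4 * n))"
      using K by (simp add: field_simps)
  qed (use K in simp)
qed

lemma (in decaying_coeffs) kernel_if_is_Psi: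
  assumes "is_Psi \<psi> \<beta> \<Psi>" and a: "a = (\<lambda>k. \<psi> (real k))"
  shows "kernel (\<beta>*pi/2) \<Psi>"
proof -
  define \<gamma> where "\<gamma> = \<beta>*pi/2"
  have per: "\<Psi> (t + 2*pi) = \<Psi> t" and meas: "\<Psi> \<in> borel_measurable borel" and int: "integrable period \<Psi>"
    and zero: "(LINT t|period. \<Psi> t) = 0"
    and cos: "1 \<le> k \<Longrightarrow> (LINT t|period. \<Psi> t * cos (real k * t)) = pi * a k * cos \<gamma>"
    and sin: "1 \<le> k \<Longrightarrow> (LINT t|period. \<Psi> t * sin (real k * t)) = pi * a k * sin \<gamma>" for t k
    using assms(1) by (auto simp: is_Psi_def periodic2pi_def set_integrable_period int_pi_eq a \<gamma>_def field_simps)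
  have "(LINT t|period. \<Psi> t * cos (real m * t + b)) = (if m = 0 then 0 else pi * a m * cos (\<gamma> + b))" for m b
  proof (cases "m = 0")
    case False
    have i: "integrable period (\<lambda>t. \<Psi> t * cos (real m * t))" "integrable period (\<lambda>t. \<Psi> t * sin (real m * t))"
      using integrable_period_mult_cos[OF int, of "real m" 0] integrable_period_mult_sin[OF int, of "real m" 0]
      by simp_all
    have "\<Psi> t * cos (real m * t + b) = \<Psi> t * cos (real m * t) * cos b - \<Psi> t * sin (real m * t) * sin b" for t
      by (simp add: cos_add algebra_simps)
    then have "(LINT t|period. \<Psi> t * cos (real m * t + b))
        = (LINT t|period. \<Psi> t * cos (real m * t)) * cos b - (LINT t|period. \<Psi> t * sin (real m * t)) * sin b"
      using i by simp
    also have "\<dots> = pi * a m * cos (\<gamma> + b)"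
    proof -
      have "1 \<le> m" using False by simp
      then show ?thesis
        by (simp only: cos sin) (simp add: cos_add algebra_simps)
    qed
    finally show ?thesis using False by simp
  qed (use zero in simp)
  then show ?thesis
    using per meas int by (simp add: kernel_def \<gamma>_def)
qed

theorem theorem1:
  fixes \<psi> :: "real \<Rightarrow> real" and p :: real
  assumes "1 < p"
    and "continuous_on {1..} \<psi>" and "\<forall>t\<ge>1. 0 < \<psi> t"
    and "\<psi> \<in> class_B" and "\<psi> \<in> class_Theta p"
  shows "\<exists>K1>0. \<exists>K2>0. \<forall>\<beta> \<Psi> (n::nat). is_Psi \<psi> \<beta> \<Psi> \<and> n \<ge> 1 \<longrightarrow>
           ereal (K2 * \<psi> (real n) * real n powr (1/p)) \<le> best_approx n (C_class p \<Psi>)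
         \<and> best_approx n (C_class p \<Psi>) \<le> fourier_dev n (C_class p \<Psi>)
         \<and> fourier_dev n (C_class p \<Psi>) \<le> ereal (K1 * \<psi> (real n) * real n powr (1/p))"
proof -
  obtain \<alpha> K where "decaying_coeffs (\<lambda>k. \<psi> (real k)) \<alpha> K p"
    using class_Theta_decaying_coeffs assms by blast
  then interpret decaying_coeffs "\<lambda>k. \<psi> (real k)" \<alpha> K p .
  obtain L where L: "0 < L" "\<And>n::nat. 1 \<le> n \<Longrightarrow> L * \<psi> (real n) \<le> \<psi> (real (4 * n))"
    using class_B_quadruple[OF assms(4)] by blast
  \<comment> \<open>Both constants are fixed before \<beta>, \<Psi> and \<open>n\<close> are
    introduced, so they depend on \<psi> and \<open>p\<close> alone.\<close>
  define c where "c = (2*pi) powr (-1/p) / 16"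
  have "0 < c"
    by (simp add: c_def)
  have "0 < deviation_const / pi"
    using deviation_const_pos by simp
  then show ?thesis
  proof (rule exI[of _ "deviation_const / pi", OF conjI], intro exI[of _ "c * L"] conjI allI impI)
    show "0 < c * L"
      using L \<open>0 < c\<close> by simp
    fix \<beta> \<Psi> and n :: nat assume "is_Psi \<psi> \<beta> \<Psi> \<and> n \<ge> 1"
    then have \<Psi>: "kernel (\<beta>*pi/2) \<Psi>" and n: "1 \<le> n"
      using kernel_if_is_Psi by auto
    have "c * (L * \<psi> (real n)) * real n powr (1/p) \<le> c * \<psi> (real (4 * n)) * real n powr (1/p)"
      using L(2)[OF n] \<open>0 < c\<close> by (intro mult_right_mono mult_left_mono) auto
    then have "ereal (c * L * \<psi> (real n) * real n powr (1/p)) \<le> ereal (c * \<psi> (real (4 * n)) * real n powr (1/p))"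
      by (simp add: mult.assoc)
    also have "\<dots> \<le> best_approx n (C_class p \<Psi>)"
      using best_approx_ge[OF \<Psi> n] by (simp only: c_def)
    finally show "ereal (c * L * \<psi> (real n) * real n powr (1/p)) \<le> best_approx n (C_class p \<Psi>)" .
    show "best_approx n (C_class p \<Psi>) \<le> fourier_dev n (C_class p \<Psi>)"
      using n by (intro best_approx_le_fourier_dev) (auto simp: C_class_def)
    show "fourier_dev n (C_class p \<Psi>) \<le> ereal (deviation_const / pi * \<psi> (real n) * real n powr (1/p))"
      by (rule fourier_dev_le[OF \<Psi> n])
  qed
qed

end
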